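(* Let $p$ be a prime with $p\equiv 1 \pmod 4$. Let $\varepsilon>0$, $p^{2/5} \le N \le p^{3/5}$, $1\le M\le p/2$ and $c\in\mathbb{F}_p^\times$. Then \[ \sum_{N\le n_1,n_2\le 2N}\Bigg|\sum_{M\le m\le 2M} S(m,cn_1,p)\overline{S(m,cn_2,p)}\Bigg| \ll_\varepsilon MN^2p^{\frac{26}{27}+\varepsilon} + MNp^{\frac{79}{54}+\varepsilon} + N^2p^{\frac{79}{54}+\varepsilon} + Np^{\frac{53}{27}+\varepsilon} + N^{\frac12}p^{\frac{239}{108}} + p^{\frac{133}{54}}. \]
   Context: $S(m,n,p)$ denotes the Salié sum $S(m,n,p) = \sum_{x \bmod p,\ (x,p)=1} \left(\frac{x}{p}\right) e\!\left(\frac{mx + n\bar{x}}{p}\right)$, where $\left(\frac{\cdot}{p}\right)$ is the Legendre symbol, $x\bar x\equiv 1\pmod p$, and $e(z)=e^{2\pi i z}$. The summation variables $n_1,n_2,m$ are integers. *)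

theory Defs
  imports Complex_Main "HOL-Number_Theory.Number_Theory"
begin

definition add_char :: "real \<Rightarrow> complex"
  where "add_char z = exp (2 * of_real pi * \<i> * of_real z)"

definition salie_sum :: "int \<Rightarrow> int \<Rightarrow> int \<Rightarrow> complex"
  where "salie_sum m n p =
    (\<Sum>x \<in> {x \<in> {0..<p}. coprime x p}.
       of_int (Legendre x p) *
       add_char (real_of_int (m * x + n * modular_inverse p x) / real_of_int p))"

definition dyadic :: "real \<Rightarrow> int set"
  where "dyadic X = {n. X \<le> real_of_int n \<and> real_of_int n \<le> 2 * X}"

end

theory Submission
  imports Defs "HOL-Analysis.Complex_Transcendental"
begin

text \<open>
  Completing the square evaluates the Salie sum: for \<open>p\<close> not dividing \<open>n\<close>, up to a factor of
  modulus \<open>p^(1/2)\<close> that does not depend on \<open>m\<close>, it equals the sum of \<open>e(y/p)\<close> over the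
  roots of \<open>y\<^sup>2 = 4mn\<close>. Writing \<open>n\<^sub>i = \<kappa>u\<^sub>i\<^sup>2\<close> and \<open>cm = \<kappa>v\<^sup>2\<close>, where \<open>\<kappa>\<close> is 1 or a fixed
  nonresidue, the correlation over \<open>m\<close> becomes an exponential sum over \<open>v\<close> at the frequencies
  \<open>2\<kappa>(u\<^sub>1 - u\<^sub>2)\<close> and \<open>2\<kappa>(u\<^sub>1 + u\<^sub>2)\<close>. By Cauchy-Schwarz and Parseval it remains to bound the
  additive energy of the modular square roots \<open>u\<close> of an interval. The representations of a given
  \<open>u\<^sub>1 + u\<^sub>2\<close> are integer points of a box of side \<open>N\<close> on a parabola modulo \<open>p\<close>; taking
  differences of two such points and using the divisor bound, there are
  \<open>O(N^(3/4) (1 + N/p^(1/2)))\<close> of them, even with the lossy bound \<open>n^(1/4)\<close> for the number of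
  divisors. If \<open>N \<ge> p^(25/54)\<close>, the result is, up to a constant, at most the geometric mean of
  the first and the third term of the claim; for smaller \<open>N\<close> the trivial bound is covered by the second term.
\<close>

section \<open>The divisor bound\<close>

text \<open>Every divisor of \<open>m * n\<close> is a divisor of \<open>m\<close> times a divisor
  of \<open>n\<close>, so multiplication maps the pairs of divisors onto the divisors of the
  product.\<close>

lemma card_divisors_mult_le:
  fixes m n :: nat
  assumes "m > 0" "n > 0"
  shows "card {d. d dvd m * n} \<le> card {d. d dvd m} * card {d. d dvd n}"
proof -
  have fin: "finite {d. d dvd m}" "finite {d. d dvd n}"
    using assms by (auto intro: finite_divisors_nat)
  have "{d. d dvd m * n} \<subseteq> (\<lambda>(a, b). a * b) ` ({d. d dvd m} \<times> {d. d dvd n})"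
    by (force dest: division_decomp)
  then have "card {d. d dvd m * n} \<le> card ({d. d dvd m} \<times> {d. d dvd n})"
    using fin by (intro surj_card_le) auto
  then show ?thesis
    by (simp add: card_cartesian_product)
qed

lemma card_divisors_prime_power_le:
  fixes q :: nat
  assumes "prime q"
  shows "card {d. d dvd q ^ a} \<le> a + 1"
proof -
  have "{d. d dvd q ^ a} \<subseteq> (\<lambda>i. q ^ i) ` {..a}"
    using divides_primepow_nat[OF assms] by auto
  then have "card {d. d dvd q ^ a} \<le> card {..a}"
    by (intro surj_card_le) auto
  then show ?thesis by simp
qed

text \<open>Strip one prime power \<open>q ^ a\<close> at a time. It multiplies the divisor count by
  at most \<open>a + 1\<close>, which is at most \<open>q powr (a * \<theta>)\<close> once
  \<open>q powr \<theta> \<ge> 2\<close>. Only the finitely many smaller primes cost an extra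
  factor, and each costs it once, whatever its exponent.\<close>

lemma divisor_bound:
  fixes \<theta> :: real
  assumes "\<theta> > 0"
  obtains C where "C \<ge> 1" "\<And>n::nat. n > 0 \<Longrightarrow> real (card {d. d dvd n}) \<le> C * real n powr \<theta>"
proof -
  define P where "P = nat \<lceil>2 powr (1 / \<theta>)\<rceil>"
  \<comment> \<open>\<open>B\<close> makes \<open>a + 1 \<le> B * (1 + a * \<theta> * ln 2)\<close>
    hold, and the bracket is at most \<open>2 powr (a * \<theta>)\<close> by
    \<open>1 + x \<le> exp x\<close>.\<close>
  define B where "B = 1 + 1 / (\<theta> * ln 2)"
  have B1: "B \<ge> 1" using assms by (simp add: B_def)
  have P: "2 \<le> real q powr \<theta>" if "q \<ge> P" for q
  proof -
    have "2 powr (1 / \<theta>) \<le> real q" using that unfolding P_def by linarith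
    then have "(2 powr (1 / \<theta>)) powr \<theta> \<le> real q powr \<theta>"
      using assms by (intro powr_mono2) auto
    then show ?thesis using assms by (simp add: powr_powr)
  qed
  have B: "real (a + 1) \<le> B * (2 powr \<theta>) ^ a" for a
  proof -
    have "1 + real a * (\<theta> * ln 2) \<le> exp (real a * (\<theta> * ln 2))" by (rule exp_ge_add_one_self)
    also have "\<dots> = (2 powr \<theta>) ^ a" by (simp add: powr_def exp_of_nat_mult)
    finally have "B * (1 + real a * (\<theta> * ln 2)) \<le> B * (2 powr \<theta>) ^ a"
      using B1 by (intro mult_left_mono) auto
    moreover have "B * (1 + real a * (\<theta> * ln 2)) = B + real a * (\<theta> * ln 2) + real a"
      using assms by (simp add: B_def field_simps)
    moreover have "real a * (\<theta> * ln 2) \<ge> 0" using assms by simp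
    ultimately show ?thesis using B1 by simp
  qed
  \<comment> \<open>The primes that pay the factor \<open>B\<close>. There are at most
    \<open>P\<close> of them for every \<open>n\<close>, which yields the constant
    \<open>B ^ P\<close>.\<close>
  define S where "S n = {q. prime q \<and> q dvd n \<and> q < P}" for n :: nat
  have finS: "finite (S n)" for n by (rule finite_subset[of _ "{..<P}"]) (auto simp: S_def)
  have main: "real (card {d. d dvd n}) \<le> B ^ card (S n) * real n powr \<theta>" if "n > 0" for n
    using that
  proof (induction n rule: less_induct)
    case (less n)
    show ?case
    proof (cases "n = 1")
      case True
      then show ?thesis using B1 by simp
    next
      case False
      then obtain q where q: "prime q" "q dvd n" using prime_factor_nat by blast
      define a where "a = multiplicity q n"
      obtain m where m: "n = q ^ a * m" "\<not> q dvd m"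
        using multiplicity_decompose'[of n q] less.prems q(1) by (metis a_def neq0_conv not_prime_unit)
      have a: "a > 0" using q less.prems by (simp add: a_def prime_multiplicity_gt_zero_iff)
      have m0: "m > 0" using m less.prems by (cases m) auto
      have q2: "q \<ge> 2" using q(1) prime_ge_2_nat by blast
      have "q ^ a > 1" using a q2 by (intro one_less_power) auto
      then have mn: "m < n" using m(1) m0 by simp
      have qpow: "r = q" if "prime r" "r dvd q ^ a" for r
        using that q(1) by (metis prime_dvd_power primes_dvd_imp_eq)
      have Sn: "S n = (if q < P then insert q (S m) else S m)"
        using q m a by (auto simp: S_def prime_dvd_mult_iff dest: qpow)
      have qS: "q \<notin> S m" using m(2) by (simp add: S_def)
      have npow: "real n powr \<theta> = (real q powr \<theta>) ^ a * real m powr \<theta>"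
        using q2 m0 by (simp add: m(1) powr_mult powr_power powr_powr mult.commute flip: powr_realpow)
      have fac: "real (a + 1) * B ^ card (S m) \<le> B ^ card (S n) * (real q powr \<theta>) ^ a"
      proof (cases "q < P")
        case True
        have "real (a + 1) \<le> B * (real q powr \<theta>) ^ a"
        proof -
          have "(2 powr \<theta>) ^ a \<le> (real q powr \<theta>) ^ a"
            using q2 assms by (intro power_mono powr_mono2) auto
          then have "B * (2 powr \<theta>) ^ a \<le> B * (real q powr \<theta>) ^ a"
            using B1 by (intro mult_left_mono) auto
          then show ?thesis using B[of a] by linarith
        qed
        then have "real (a + 1) * B ^ card (S m) \<le> B * (real q powr \<theta>) ^ a * B ^ card (S m)"
          using B1 by (intro mult_right_mono) auto
        then show ?thesis using True Sn qS finS by (simp add: mult_ac)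
      next
        case False
        have "real (a + 1) \<le> 2 ^ a"
          by (metis Suc_eq_plus1 Suc_leI less_exp of_nat_le_numeral_power_cancel_iff)
        also have "\<dots> \<le> (real q powr \<theta>) ^ a"
          using P[of q] False by (intro power_mono) auto
        finally have "real (a + 1) * B ^ card (S m) \<le> (real q powr \<theta>) ^ a * B ^ card (S m)"
          using B1 by (intro mult_right_mono) auto
        then show ?thesis using False Sn by (simp add: mult_ac)
      qed
      have "real (card {d. d dvd n}) \<le> real (card {d. d dvd q ^ a} * card {d. d dvd m})"
        using card_divisors_mult_le[of "q ^ a" m] q2 m0 by (simp add: m(1) flip: of_nat_mult)
      also have "\<dots> \<le> real (a + 1) * (B ^ card (S m) * real m powr \<theta>)"
        using card_divisors_prime_power_le[OF q(1), of a] less.IH[OF mn m0]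
        unfolding of_nat_mult by (intro mult_mono) auto
      also have "\<dots> = real (a + 1) * B ^ card (S m) * real m powr \<theta>" by simp
      also have "\<dots> \<le> B ^ card (S n) * (real q powr \<theta>) ^ a * real m powr \<theta>"
        using fac by (intro mult_right_mono) auto
      also have "\<dots> = B ^ card (S n) * real n powr \<theta>" by (simp add: npow)
      finally show ?thesis .
    qed
  qed
  show thesis
  proof (rule that)
    show "B ^ P \<ge> 1" using B1 by (rule one_le_power)
    fix n :: nat assume "n > 0"
    have "card (S n) \<le> P"
      using card_mono[of "{..<P}" "S n"] by (auto simp: S_def)
    then have "B ^ card (S n) * real n powr \<theta> \<le> B ^ P * real n powr \<theta>"
      using B1 by (intro mult_right_mono power_increasing) auto
    with main[OF \<open>n > 0\<close>] show "real (card {d. d dvd n}) \<le> B ^ P * real n powr \<theta>" by linarith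
  qed
qed

section \<open>Evaluation of the Salie sum\<close>

locale odd_prime =
  fixes p :: int
  assumes prime_p: "prime p" and p_gt_2: "p > 2"
begin

section \<open>The additive character modulo \<open>p\<close> and complete sums\<close>

definition e :: "int \<Rightarrow> complex"
  where "e x = add_char (real_of_int x / real_of_int p)"

definition sqroots :: "int \<Rightarrow> int set"
  where "sqroots a = {y \<in> {0..<p}. [y\<^sup>2 = a] (mod p)}"

text \<open>Its argument is left undetermined; what enters the evaluation of products of Salie sums
  is \<open>gauss * cnj gauss = p\<close>.\<close>

definition gauss :: complex
  where "gauss = (\<Sum>a\<in>{0..<p}. of_int (Legendre a p) * e a)"

lemma p_pos: "p > 0" using p_gt_2 by simp

lemma e_add: "e (x + y) = e x * e y"
  by (simp add: e_def add_char_def add_divide_distrib distrib_left exp_add)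

lemma e_0 [simp]: "e 0 = 1"
  by (simp add: e_def add_char_def)

lemma norm_e [simp]: "norm (e x) = 1"
  by (simp add: e_def add_char_def)

lemma cnj_e: "cnj (e x) = e (- x)"
  by (simp add: e_def add_char_def exp_cnj)

lemma e_eq_1_iff: "e x = 1 \<longleftrightarrow> p dvd x"
proof -
  have "e x = 1 \<longleftrightarrow> (\<exists>n::int. 2 * pi * (real_of_int x / real_of_int p) = real_of_int (2 * n) * pi)"
    by (simp add: e_def add_char_def exp_eq_1)
  also have "\<dots> \<longleftrightarrow> (\<exists>n::int. real_of_int x = real_of_int (p * n))"
    using p_pos by (auto simp: field_simps)
  also have "\<dots> \<longleftrightarrow> p dvd x"
    unfolding of_int_eq_iff by (auto simp: dvd_def)
  finally show ?thesis .
qed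

lemma e_cong: "[x = y] (mod p) \<Longrightarrow> e x = e y"
proof -
  assume "[x = y] (mod p)"
  then have "e (x - y) = 1"
    by (simp add: e_eq_1_iff cong_iff_dvd_diff)
  then show "e x = e y"
    using e_add[of "x - y" y] by simp
qed

lemma e_mod [simp]: "e (x mod p) = e x"
  by (rule e_cong) (simp add: cong_def)

lemma not_dvd_2: "\<not> p dvd 2"
  using p_gt_2 zdvd_imp_le by fastforce

lemma not_dvd_4: "\<not> p dvd 4"
  using not_dvd_2 prime_dvd_mult_iff[OF prime_p, of 2 2] by simp

lemma coprime_p: "coprime a p \<longleftrightarrow> \<not> p dvd a"
  using prime_p by (metis coprime_commute not_coprimeI prime_imp_coprime_int dvd_refl not_prime_unit)

lemma cong_mult_cancel: "\<not> p dvd a \<Longrightarrow> [a * x = a * y] (mod p) \<longleftrightarrow> [x = y] (mod p)"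
  using coprime_p by (simp add: cong_mult_lcancel)

lemma residue_eq_iff: "x \<in> {0..<p} \<Longrightarrow> y \<in> {0..<p} \<Longrightarrow> [x = y] (mod p) \<longleftrightarrow> x = y"
  by (auto simp: cong_def)

lemma affine_bij_betw:
  assumes "\<not> p dvd a"
  shows "bij_betw (\<lambda>x. (a * x + b) mod p) {0..<p} {0..<p}"
proof -
  have inj: "inj_on (\<lambda>x. (a * x + b) mod p) {0..<p}"
  proof (rule inj_onI)
    fix x y assume xy: "x \<in> {0..<p}" "y \<in> {0..<p}" "(a * x + b) mod p = (a * y + b) mod p"
    then have "[a * x + b = a * y + b] (mod p)" by (simp add: cong_def)
    then have "[a * x = a * y] (mod p)" by (simp add: cong_add_rcancel)
    then show "x = y" using assms xy cong_mult_cancel residue_eq_iff by blast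
  qed
  have "(\<lambda>x. (a * x + b) mod p) ` {0..<p} \<subseteq> {0..<p}" using p_pos by auto
  then have "(\<lambda>x. (a * x + b) mod p) ` {0..<p} = {0..<p}"
    using inj by (intro endo_inj_surj) auto
  with inj show ?thesis by (simp add: bij_betw_def)
qed

text \<open>The first premise is periodicity modulo \<open>p\<close>; an affine map with invertible
  slope permutes the residues. This is the change of variables for the shifts and dilations of
  complete sums below.\<close>

lemma sum_residues_affine:
  fixes f :: "int \<Rightarrow> 'b::comm_monoid_add"
  assumes "\<And>x. f (x mod p) = f x" "\<not> p dvd a"
  shows "(\<Sum>x\<in>{0..<p}. f (a * x + b)) = (\<Sum>x\<in>{0..<p}. f x)"
  using sum.reindex_bij_betw[OF affine_bij_betw[OF assms(2)], of f b] by (simp add: assms(1))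

lemma sum_e: "(\<Sum>x\<in>{0..<p}. e (a * x)) = (if p dvd a then of_int p else 0)"
proof (cases "p dvd a")
  case True
  then have "e (a * x) = 1" for x by (simp add: e_eq_1_iff)
  then show ?thesis using True p_pos by simp
next
  case False
  \<comment> \<open>Shifting \<open>x\<close> by 1 multiplies the sum by \<open>e a\<close>, which
    differs from 1, so the sum vanishes.\<close>
  have "(\<Sum>x\<in>{0..<p}. e (a * x)) = (\<Sum>x\<in>{0..<p}. e (a * (1 * x + 1)))"
    by (rule sum_residues_affine[symmetric])
       (use p_gt_2 in \<open>auto intro!: e_cong cong_mult simp: cong_def zdvd_not_zless mod_mult_right_eq\<close>)
  also have "\<dots> = e a * (\<Sum>x\<in>{0..<p}. e (a * x))"
    by (simp add: sum_distrib_left distrib_left e_add mult.commute)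
  finally have "(\<Sum>x\<in>{0..<p}. e (a * x)) * (e a - 1) = 0" by (simp add: algebra_simps)
  then show ?thesis using False by (simp add: e_eq_1_iff)
qed

section \<open>Legendre symbols and square roots modulo \<open>p\<close>\<close>

lemma Legendre_mult: "Legendre (a * b) p = Legendre a p * Legendre b p"
proof -
  have p: "prime (nat p)" "nat p > 2" "int (nat p) = p" using prime_p p_gt_2 by auto
  have ec: "[Legendre x p = x ^ ((nat p - 1) div 2)] (mod p)" for x
    using euler_criterion[of "nat p" x] p by simp
  have "[Legendre a p * Legendre b p = a ^ ((nat p - 1) div 2) * b ^ ((nat p - 1) div 2)] (mod p)"
    by (intro cong_mult ec)
  also have "a ^ ((nat p - 1) div 2) * b ^ ((nat p - 1) div 2) = (a * b) ^ ((nat p - 1) div 2)"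
    by (simp add: power_mult_distrib)
  also have "[(a * b) ^ ((nat p - 1) div 2) = Legendre (a * b) p] (mod p)"
    by (rule cong_sym[OF ec])
  finally have "p dvd Legendre a p * Legendre b p - Legendre (a * b) p"
    by (simp add: cong_iff_dvd_diff)
  \<comment> \<open>Euler's criterion makes both sides congruent modulo \<open>p\<close>. Their
    values are among -1, 0 and 1, so they differ by at most 2, which is less than
    \<open>p\<close>.\<close>
  moreover have "\<bar>Legendre a p * Legendre b p - Legendre (a * b) p\<bar> \<le> 2"
    by (auto simp: Legendre_def)
  ultimately show ?thesis
    using p_gt_2 dvd_imp_le_int[of "Legendre a p * Legendre b p - Legendre (a * b) p" p] by force
qed

lemma Legendre_cong: "[a = b] (mod p) \<Longrightarrow> Legendre a p = Legendre b p"
  by (auto simp: Legendre_def QuadRes_def cong_def)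

lemma Legendre_mod [simp]: "Legendre (a mod p) p = Legendre a p"
  by (rule Legendre_cong) (simp add: cong_def)

lemma Legendre_square: "\<not> p dvd a \<Longrightarrow> Legendre a p * Legendre a p = 1"
  by (auto simp: Legendre_def cong_0_iff)

lemma Legendre_1: "Legendre 1 p = 1"
  using p_gt_2 by (auto simp: Legendre_def QuadRes_def cong_0_iff zdvd_not_zless intro!: exI[of _ 1])

text \<open>Two roots satisfy \<open>p dvd (y - v) * (y + v)\<close>, so primality leaves only
  \<open>v\<close> and its negative, represented by \<open>p - v\<close>. These differ because
  \<open>p\<close> is odd.\<close>

lemma sqroots_eq:
  assumes "v \<in> sqroots a" "\<not> p dvd a"
  shows "sqroots a = {v, p - v}" "v \<noteq> p - v" "v \<noteq> 0"
proof -
  have v: "0 \<le> v" "v < p" "[v\<^sup>2 = a] (mod p)" using assms(1) by (auto simp: sqroots_def)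
  show v0: "v \<noteq> 0" using v assms(2) by (auto simp: cong_def dvd_eq_mod_eq_0)
  show "v \<noteq> p - v"
  proof
    assume "v = p - v"
    then have "p = 2 * v" by simp
    then show False using prime_p p_gt_2 by (metis dvd_triv_left primes_dvd_imp_eq two_is_prime less_irrefl)
  qed
  have "[(p - v)\<^sup>2 = v\<^sup>2] (mod p)"
    by (simp add: cong_iff_dvd_diff power2_eq_square algebra_simps)
  then have "p - v \<in> sqroots a" using v v0 by (auto simp: sqroots_def intro: cong_trans)
  moreover have "y = v \<or> y = p - v" if "y \<in> sqroots a" for y
  proof -
    have y: "0 \<le> y" "y < p" "[y\<^sup>2 = a] (mod p)" using that by (auto simp: sqroots_def)
    then have "[y\<^sup>2 = v\<^sup>2] (mod p)" using v by (metis cong_sym cong_trans)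
    then have "p dvd (y - v) * (y + v)"
      by (simp add: cong_iff_dvd_diff power2_eq_square algebra_simps)
    then have "p dvd y - v \<or> p dvd y + v" using prime_p by (simp add: prime_dvd_mult_iff)
    then show ?thesis
    proof
      assume "p dvd y - v"
      then show ?thesis using v y residue_eq_iff[of y v] by (simp add: cong_iff_dvd_diff)
    next
      assume "p dvd y + v"
      then have "p dvd y - (p - v)" by (simp add: algebra_simps dvd_diff)
      then show ?thesis using v y v0 residue_eq_iff[of y "p - v"] by (simp add: cong_iff_dvd_diff)
    qed
  qed
  ultimately show "sqroots a = {v, p - v}" using assms(1) by blast
qed

lemma sqroots_0: "p dvd a \<Longrightarrow> sqroots a = {0}"
proof -
  assume a: "p dvd a"
  then have "[y\<^sup>2 = a] (mod p) \<longleftrightarrow> p dvd y" for y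
    using prime_p
    by (metis cong_def dvd_eq_mod_eq_0 zero_less_numeral prime_imp_prime_elem prime_elem_dvd_power_iff)
  then show "sqroots a = {0}" using p_pos by (auto simp: sqroots_def zdvd_not_zless dest: zdvd_imp_le)
qed

lemma card_sqroots: "int (card (sqroots a)) = 1 + Legendre a p"
proof (cases "p dvd a")
  case True
  then show ?thesis by (simp add: sqroots_0 Legendre_def cong_0_iff)
next
  case a: False
  show ?thesis
  proof (cases "QuadRes p a")
    case True
    then obtain y where "[y\<^sup>2 = a] (mod p)" by (auto simp: QuadRes_def)
    then have "y mod p \<in> sqroots a" using p_pos by (simp add: sqroots_def cong_def power_mod)
    from sqroots_eq[OF this a] show ?thesis
      using True a by (simp add: Legendre_def cong_0_iff)
  next
    case False
    then have "sqroots a = {}" by (auto simp: sqroots_def QuadRes_def)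
    then show ?thesis using False a by (simp add: Legendre_def cong_0_iff)
  qed
qed

lemma card_sqroots_le: "card (sqroots a) \<le> 2"
  using card_sqroots[of a] by (auto simp: Legendre_def split: if_splits)

lemma finite_sqroots [simp]: "finite (sqroots a)"
  by (rule finite_subset[of _ "{0..<p}"]) (auto simp: sqroots_def)

section \<open>Quadratic Gauss sums\<close>

lemma sum_square_residues:
  fixes f :: "int \<Rightarrow> complex"
  assumes "\<And>x. f (x mod p) = f x"
  shows "(\<Sum>y\<in>{0..<p}. f (y\<^sup>2)) = (\<Sum>a\<in>{0..<p}. of_int (1 + Legendre a p) * f a)"
proof -
  have "(\<Sum>y\<in>{0..<p}. f (y\<^sup>2)) = (\<Sum>a\<in>{0..<p}. \<Sum>y | y \<in> {0..<p} \<and> y\<^sup>2 mod p = a. f (y\<^sup>2))"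
    using p_pos by (intro sum.group[symmetric]) auto
  also have "\<dots> = (\<Sum>a\<in>{0..<p}. \<Sum>y\<in>sqroots a. f a)"
  proof (intro sum.cong refl)
    fix a assume "a \<in> {0..<p}"
    then show "{y. y \<in> {0..<p} \<and> y\<^sup>2 mod p = a} = sqroots a"
      by (auto simp: sqroots_def cong_def)
    fix y assume "y \<in> sqroots a"
    then have "y\<^sup>2 mod p = a mod p" by (simp add: sqroots_def cong_def)
    then show "f (y\<^sup>2) = f a" by (metis assms)
  qed
  also have "\<dots> = (\<Sum>a\<in>{0..<p}. of_int (1 + Legendre a p) * f a)"
    by (simp flip: card_sqroots)
  finally show ?thesis .
qed

text \<open>Counting square roots by \<open>1 + Legendre a p\<close> splits the sum. The part with 1
  is a complete character sum and vanishes; in the other part a dilation by \<open>t\<close> brings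
  out the symbol of \<open>t\<close>.\<close>

lemma quadratic_gauss_sum:
  assumes "\<not> p dvd t"
  shows "(\<Sum>y\<in>{0..<p}. e (t * y\<^sup>2)) = of_int (Legendre t p) * gauss"
proof -
  have per: "e (t * (x mod p)) = e (t * x)" for x
    by (rule e_cong) (simp add: cong_def mod_mult_right_eq)
  have "(\<Sum>y\<in>{0..<p}. e (t * y\<^sup>2)) = (\<Sum>a\<in>{0..<p}. of_int (1 + Legendre a p) * e (t * a))"
    by (rule sum_square_residues[of "\<lambda>a. e (t * a)"]) (rule per)
  also have "\<dots> = (\<Sum>a\<in>{0..<p}. of_int (Legendre a p) * e (t * a))"
    using sum_e[of t] assms by (simp add: distrib_right sum.distrib)
  \<comment> \<open>Inserting the square of \<open>Legendre t p\<close>, which is 1, makes the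
    remaining factor a function of \<open>t * a\<close>.\<close>
  also have "\<dots> = (\<Sum>a\<in>{0..<p}. of_int (Legendre t p) * (of_int (Legendre (t * a) p) * e (t * a)))"
    using Legendre_square[OF assms]
    by (intro sum.cong refl)
       (simp add: Legendre_mult flip: mult.assoc of_int_mult)
  also have "\<dots> = of_int (Legendre t p) * (\<Sum>a\<in>{0..<p}. of_int (Legendre (t * a + 0) p) * e (t * a + 0))"
    by (simp add: sum_distrib_left)
  also have "\<dots> = of_int (Legendre t p) * gauss"
    unfolding gauss_def
    by (subst sum_residues_affine[of "\<lambda>a. of_int (Legendre a p) * e a"]) (use assms in auto)
  finally show ?thesis .
qed

text \<open>Differencing: with \<open>x = h + y\<close> the phase
  \<open>x\<^sup>2 - y\<^sup>2\<close> is linear in \<open>y\<close>, and orthogonality in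
  \<open>y\<close> leaves only \<open>h = 0\<close>.\<close>

lemma gauss_mult_cnj: "gauss * cnj gauss = of_int p"
proof -
  have g: "gauss = (\<Sum>y\<in>{0..<p}. e (y\<^sup>2))"
    using quadratic_gauss_sum[of 1] p_gt_2 by (simp add: Legendre_1 zdvd_not_zless)
  have per: "e ((x mod p)\<^sup>2) = e (x\<^sup>2)" for x
    by (rule e_cong) (simp add: cong_def power_mod)
  have "gauss * cnj gauss = (\<Sum>y\<in>{0..<p}. (\<Sum>x\<in>{0..<p}. e (x\<^sup>2)) * e (- y\<^sup>2))"
    by (simp add: g cnj_e sum_distrib_left)
  also have "\<dots> = (\<Sum>y\<in>{0..<p}. (\<Sum>h\<in>{0..<p}. e ((1 * h + y)\<^sup>2)) * e (- y\<^sup>2))"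
    by (subst sum_residues_affine[of "\<lambda>x. e (x\<^sup>2)"]) (use p_gt_2 in \<open>auto simp: per zdvd_not_zless\<close>)
  also have "\<dots> = (\<Sum>y\<in>{0..<p}. \<Sum>h\<in>{0..<p}. e (h\<^sup>2) * e (2 * h * y))"
    unfolding sum_distrib_right
    by (intro sum.cong refl) (simp add: power2_eq_square algebra_simps flip: e_add)
  also have "\<dots> = (\<Sum>h\<in>{0..<p}. e (h\<^sup>2) * (\<Sum>y\<in>{0..<p}. e (2 * h * y)))"
    by (subst sum.swap) (simp add: sum_distrib_left)
  also have "\<dots> = (\<Sum>h\<in>{0..<p}. if h = 0 then of_int p else 0)"
  proof (intro sum.cong refl)
    fix h assume "h \<in> {0..<p}"
    then have "p dvd 2 * h \<longleftrightarrow> h = 0"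
      using prime_p not_dvd_2 by (auto simp: prime_dvd_mult_iff zdvd_not_zless dest: zdvd_imp_le)
    then show "e (h\<^sup>2) * (\<Sum>y\<in>{0..<p}. e (2 * h * y)) = (if h = 0 then of_int p else 0)"
      by (simp add: sum_e)
  qed
  also have "\<dots> = of_int p" using p_pos by simp
  finally show ?thesis .
qed

text \<open>Completing the square: \<open>s\<close> is the inverse of \<open>4 * t\<close>, and
  \<open>t * y\<^sup>2 + y\<close> becomes \<open>t * (y + 2 * s)\<^sup>2 - s\<close>. The factor
  \<open>e (- s)\<close> is the source of the modular inverse in the Salie sum.\<close>

lemma quadratic_gauss_sum_shifted:
  assumes "[4 * t * s = 1] (mod p)"
  shows "(\<Sum>y\<in>{0..<p}. e (t * y\<^sup>2 + y)) = e (- s) * of_int (Legendre t p) * gauss"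
proof -
  have t: "\<not> p dvd t"
    using assms p_gt_2 by (metis cong_dvd_iff dvd_mult dvd_mult2 not_prime_unit prime_p)
  have per: "e (t * (x mod p)\<^sup>2 - s) = e (t * x\<^sup>2 - s)" for x
    by (intro e_cong cong_diff cong_mult) (auto simp: cong_def power_mod)
  have "e (t * y\<^sup>2 + y) = e (t * (1 * y + 2 * s)\<^sup>2 - s)" for y
  proof (rule e_cong)
    have "p dvd (4 * t * s - 1) * (y + s)"
      using assms by (simp add: cong_iff_dvd_diff)
    moreover have "(4 * t * s - 1) * (y + s) = (t * (1 * y + 2 * s)\<^sup>2 - s) - (t * y\<^sup>2 + y)"
      by (simp add: power2_eq_square algebra_simps)
    ultimately show "[t * y\<^sup>2 + y = t * (1 * y + 2 * s)\<^sup>2 - s] (mod p)"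
      by (metis cong_iff_dvd_diff cong_sym)
  qed
  then have "(\<Sum>y\<in>{0..<p}. e (t * y\<^sup>2 + y)) = (\<Sum>y\<in>{0..<p}. e (t * (1 * y + 2 * s)\<^sup>2 - s))"
    by simp
  also have "\<dots> = (\<Sum>y\<in>{0..<p}. e (t * y\<^sup>2 - s))"
    by (rule sum_residues_affine[of "\<lambda>x. e (t * x\<^sup>2 - s)"])
       (use p_gt_2 in \<open>auto simp: per zdvd_not_zless\<close>)
  also have "\<dots> = e (- s) * (\<Sum>y\<in>{0..<p}. e (t * y\<^sup>2))"
    by (simp add: sum_distrib_left flip: e_add)
  finally show ?thesis using quadratic_gauss_sum[OF t] by simp
qed

section \<open>Salie sums as sums over square roots\<close>

definition root_sum :: "int \<Rightarrow> int \<Rightarrow> complex"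
  where "root_sum n m = (\<Sum>y\<in>sqroots (4 * m * n). e y)"

text \<open>After the substitution \<open>x = - 4 * n * t\<close>, each Salie summand times the
  Gauss sum is a complete quadratic sum over \<open>y\<close> times a phase linear in
  \<open>t\<close>. Summing over \<open>t\<close> first then detects
  \<open>y\<^sup>2 = 4 * m * n\<close>. The Gauss sum stays on the left to avoid a division.\<close>

lemma salie_sum_eq:
  assumes n: "\<not> p dvd n"
  shows "gauss * of_int (Legendre (- n) p) * salie_sum m n p = of_int p * root_sum n m"
proof -
  \<comment> \<open>Extending the summand by 0 to the multiples of \<open>p\<close> gives a periodic
    function of all integers, to which the affine change of variables applies.\<close>
  define F where "F x = (if p dvd x then 0
    else of_int (Legendre x p) * e (m * x + n * modular_inverse p x))" for x
  have inv_mod: "modular_inverse p (x mod p) = modular_inverse p x" if "\<not> p dvd x" for x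
  proof (rule modular_inverse_int_eqI)
    show "modular_inverse p x \<in> {0..<p}"
      using modular_inverse_int_nonneg modular_inverse_int_less p_pos by auto
    have "[(x mod p) * modular_inverse p x = x * modular_inverse p x] (mod p)"
      by (intro cong_mult) (auto simp: cong_def)
    also have "[x * modular_inverse p x = 1] (mod p)"
      using that by (intro cong_modular_inverse1) (simp add: coprime_p)
    finally show "[(x mod p) * modular_inverse p x = 1] (mod p)" .
  qed
  have F_mod: "F (x mod p) = F x" for x
  proof -
    have "e (m * (x mod p) + n * modular_inverse p x) = e (m * x + n * modular_inverse p x)"
      by (intro e_cong cong_add cong_mult) (auto simp: cong_def)
    then show ?thesis by (auto simp: F_def inv_mod dvd_mod_iff)
  qed
  have "salie_sum m n p = (\<Sum>x \<in> {x \<in> {0..<p}. coprime x p}. F x)"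
    unfolding salie_sum_def e_def[symmetric] by (intro sum.cong refl) (auto simp: F_def coprime_p)
  also have "\<dots> = (\<Sum>x \<in> {0..<p}. F x)"
    by (intro sum.mono_neutral_left) (auto simp: F_def coprime_p)
  also have "\<dots> = (\<Sum>t \<in> {0..<p}. F ((- 4 * n) * t + 0))"
    using n not_dvd_4 prime_p
    by (intro sum_residues_affine[symmetric] F_mod) (simp add: prime_dvd_mult_iff)
  finally have S: "salie_sum m n p = (\<Sum>t \<in> {0..<p}. F (- 4 * n * t))" by simp
  have summand: "gauss * of_int (Legendre (- n) p) * F (- 4 * n * t) =
      e (- (4 * m * n * t)) * (\<Sum>y\<in>{0..<p}. e (t * y\<^sup>2 + y))" if "t \<in> {0..<p}" for t
  proof (cases "t = 0")
    case True
    \<comment> \<open>At \<open>t = 0\<close> both sides are 0: the left by the convention in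
      \<open>F\<close>, the right because a nontrivial character has complete sum 0.\<close>
    have "(\<Sum>y\<in>{0..<p}. e (1 * y)) = 0" using sum_e[of 1] p_gt_2 by (simp add: zdvd_not_zless)
    then show ?thesis using True by (simp add: F_def)
  next
    case False
    then have t: "\<not> p dvd t" using that by (auto simp: zdvd_not_zless)
    have t4: "\<not> p dvd 4 * t" and nt: "\<not> p dvd - 4 * n * t"
      using n t not_dvd_4 prime_p by (auto simp: prime_dvd_mult_iff)
    define s where "s = modular_inverse p (4 * t)"
    define i where "i = modular_inverse p (- 4 * n * t)"
    have s: "[4 * t * s = 1] (mod p)"
      unfolding s_def using t4 by (intro cong_modular_inverse1) (simp add: coprime_p)
    have i: "[- 4 * n * t * i = 1] (mod p)"
      unfolding i_def using nt by (intro cong_modular_inverse1) (simp add: coprime_p)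
    have "[4 * t * (- (n * i)) = 4 * t * s] (mod p)"
      using cong_trans[OF i cong_sym[OF s]] by (simp add: mult_ac)
    then have "[- (n * i) = s] (mod p)" using cong_mult_cancel[OF t4] by blast
    \<comment> \<open>The inverse term of the Salie phase is thus minus the inverse of
      \<open>4 * t\<close>, exactly the phase produced by completing the square.\<close>
    then have ni: "[n * i = - s] (mod p)" by (metis cong_minus_minus_iff minus_minus)
    have e1: "e (m * (- 4 * n * t) + n * i) = e (- (4 * m * n * t)) * e (- s)"
      unfolding e_add e_cong[OF ni] by (simp add: mult_ac)
    have L4: "Legendre 4 p = 1"
      using Legendre_mult[of 2 2] Legendre_square[OF not_dvd_2] by simp
    have "- 4 * n * t = 4 * (- n * t)" by simp
    then have "Legendre (- 4 * n * t) p = Legendre (- n) p * Legendre t p"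
      by (simp only: Legendre_mult L4)
    moreover have "Legendre (- n) p * Legendre (- n) p = 1" using n by (intro Legendre_square) simp
    ultimately have L: "Legendre (- n) p * Legendre (- 4 * n * t) p = Legendre t p"
      by (simp flip: mult.assoc)
    have "gauss * of_int (Legendre (- n) p) * F (- 4 * n * t) =
        gauss * of_int (Legendre (- n) p * Legendre (- 4 * n * t) p) * e (m * (- 4 * n * t) + n * i)"
      using nt by (simp add: F_def i_def)
    also have "\<dots> = e (- (4 * m * n * t)) * (e (- s) * of_int (Legendre t p) * gauss)"
      unfolding L e1 by (simp add: mult_ac)
    finally show ?thesis using quadratic_gauss_sum_shifted[OF s] by simp
  qed
  have "gauss * of_int (Legendre (- n) p) * salie_sum m n p =
      (\<Sum>t \<in> {0..<p}. gauss * of_int (Legendre (- n) p) * F (- 4 * n * t))"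
    unfolding S by (rule sum_distrib_left)
  also have "\<dots> = (\<Sum>t \<in> {0..<p}. e (- (4 * m * n * t)) * (\<Sum>y\<in>{0..<p}. e (t * y\<^sup>2 + y)))"
    by (intro sum.cong refl summand)
  also have "\<dots> = (\<Sum>t \<in> {0..<p}. \<Sum>y\<in>{0..<p}. e y * e ((y\<^sup>2 - 4 * m * n) * t))"
    unfolding sum_distrib_left by (intro sum.cong refl) (simp add: algebra_simps flip: e_add)
  also have "\<dots> = (\<Sum>y\<in>{0..<p}. e y * (\<Sum>t \<in> {0..<p}. e ((y\<^sup>2 - 4 * m * n) * t)))"
    by (subst sum.swap) (simp add: sum_distrib_left)
  also have "\<dots> = (\<Sum>y\<in>{0..<p}. if y \<in> sqroots (4 * m * n) then of_int p * e y else 0)"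
    by (intro sum.cong refl) (simp add: sum_e sqroots_def cong_iff_dvd_diff)
  also have "\<dots> = of_int p * root_sum n m"
    unfolding root_sum_def sum_distrib_left
    by (intro sum.mono_neutral_cong_right) (auto simp: sqroots_def)
  finally show ?thesis .
qed

text \<open>The two Gauss factors are conjugate and multiply to \<open>p\<close>, so one of the two
  factors \<open>p\<close> from \<open>salie_sum_eq\<close> survives. Neither it nor the two signs
  depend on \<open>m\<close>, so they can leave a sum over \<open>m\<close>.\<close>

lemma salie_sum_mult_cnj:
  assumes "\<not> p dvd n1" "\<not> p dvd n2"
  shows "salie_sum m n1 p * cnj (salie_sum m n2 p) =
    of_int (p * Legendre (- n1) p * Legendre (- n2) p) * (root_sum n1 m * cnj (root_sum n2 m))"
proof -
  define a where "a = Legendre (- n1) p"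
  define b where "b = Legendre (- n2) p"
  have ab: "of_int a * of_int a = (1::complex)" "of_int b * of_int b = (1::complex)"
    using assms Legendre_square[of "- n1"] Legendre_square[of "- n2"]
    by (auto simp: a_def b_def simp flip: of_int_mult)
  define s1 where "s1 = salie_sum m n1 p"
  define s2 where "s2 = cnj (salie_sum m n2 p)"
  have 1: "gauss * of_int a * s1 = of_int p * root_sum n1 m"
    using salie_sum_eq[OF assms(1)] by (simp add: a_def s1_def)
  have 2: "cnj gauss * of_int b * s2 = of_int p * cnj (root_sum n2 m)"
    using arg_cong[OF salie_sum_eq[OF assms(2), of m], of cnj] by (simp add: b_def s2_def)
  have "of_int p * (of_int a * of_int b * (s1 * s2)) =
      (gauss * of_int a * s1) * (cnj gauss * of_int b * s2)"
    by (simp add: mult_ac flip: gauss_mult_cnj)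
  also have "\<dots> = of_int p * (of_int p * (root_sum n1 m * cnj (root_sum n2 m)))"
    unfolding 1 2 by (simp add: mult_ac)
  finally have "of_int a * of_int b * (s1 * s2) = of_int p * (root_sum n1 m * cnj (root_sum n2 m))"
    using p_pos by simp
  then have "(of_int a * of_int a) * (of_int b * of_int b) * (s1 * s2) =
      of_int a * of_int b * (of_int p * (root_sum n1 m * cnj (root_sum n2 m)))"
    by (metis (no_types, lifting) mult.assoc mult.left_commute)
  then show ?thesis unfolding ab by (simp add: s1_def s2_def a_def b_def mult_ac)
qed

lemma norm_root_sum_le: "norm (root_sum n m) \<le> 2"
proof -
  have "norm (root_sum n m) \<le> (\<Sum>y\<in>sqroots (4 * m * n). norm (e y))"
    unfolding root_sum_def by (rule norm_sum)
  also have "\<dots> \<le> 2" using card_sqroots_le[of "4 * m * n"] by simp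
  finally show ?thesis .
qed

lemma norm_sum_salie:
  assumes "\<not> p dvd n1" "\<not> p dvd n2"
  shows "norm (\<Sum>m\<in>B. salie_sum m n1 p * cnj (salie_sum m n2 p)) =
    of_int p * norm (\<Sum>m\<in>B. root_sum n1 m * cnj (root_sum n2 m))"
proof -
  have "\<bar>Legendre (- n1) p\<bar> = 1" "\<bar>Legendre (- n2) p\<bar> = 1"
    using assms by (auto simp: Legendre_def cong_0_iff)
  then have "norm (of_int (p * Legendre (- n1) p * Legendre (- n2) p) :: complex) = of_int p"
    using p_pos by (simp add: norm_mult flip: of_int_abs)
  then show ?thesis
    by (simp only: salie_sum_mult_cnj[OF assms] norm_mult flip: sum_distrib_left)
qed

end

section \<open>Square roots with a given sum\<close>

lemma card_mult_eq_le:
  fixes k :: int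
  assumes "k \<noteq> 0"
  shows "finite {(a, b). a * b = k}" "card {(a, b). a * b = k} \<le> 2 * card {d. d dvd nat \<bar>k\<bar>}"
proof -
  let ?D = "{d. d dvd nat \<bar>k\<bar>}"
  have fin: "finite ?D" using assms by (intro finite_divisors_nat) simp
  have sub: "fst ` {(a, b). a * b = k} \<subseteq> int ` ?D \<union> (\<lambda>d. - int d) ` ?D"
  proof
    fix a assume "a \<in> fst ` {(a, b). a * b = k}"
    then have "a dvd k" by auto
    then have "nat \<bar>a\<bar> \<in> ?D" by (simp add: nat_dvd_iff)
    moreover have "a = int (nat \<bar>a\<bar>) \<or> a = - int (nat \<bar>a\<bar>)" by linarith
    ultimately show "a \<in> int ` ?D \<union> (\<lambda>d. - int d) ` ?D" by blast
  qed
  have inj: "inj_on fst {(a, b). a * b = k}"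
    using assms by (auto simp: inj_on_def)
  show "finite {(a, b). a * b = k}"
    using inj finite_subset[OF sub] fin by (intro finite_imageD[OF _ inj]) auto
  have "card {(a, b). a * b = k} = card (fst ` {(a, b). a * b = k})"
    using inj by (simp add: card_image)
  also have "\<dots> \<le> card (int ` ?D \<union> (\<lambda>d. - int d) ` ?D)"
    using fin sub by (intro card_mono) auto
  also have "\<dots> \<le> card (int ` ?D) + card ((\<lambda>d. - int d) ` ?D)" by (rule card_Un_le)
  also have "\<dots> \<le> 2 * card ?D"
    using card_image_le[OF fin, of int] card_image_le[OF fin, of "\<lambda>d. - int d"] by simp
  finally show "card {(a, b). a * b = k} \<le> 2 * card ?D" .
qed

context odd_prime
begin

text \<open>Within a residue class \<open>k div p\<close> determines \<open>k\<close>, and it ranges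
  over an interval of about \<open>2 * X / p\<close> quotients.\<close>

lemma card_residue_class_le:
  assumes "X \<ge> 0"
  shows "real (card {k \<in> {- X..X}. [k = r] (mod p)}) \<le> 2 * of_int X / of_int p + 2"
proof -
  let ?K = "{k \<in> {- X..X}. [k = r] (mod p)}"
  have inj: "inj_on (\<lambda>k. k div p) ?K"
    by (rule inj_onI) (metis (mono_tags, lifting) cong_def div_mult_mod_eq mem_Collect_eq)
  have sub: "(\<lambda>k. k div p) ` ?K \<subseteq> {(- X) div p..X div p}"
    using p_pos by (auto intro!: zdiv_mono1)
  have le: "(- X) div p \<le> X div p" using assms p_pos by (intro zdiv_mono1) auto
  have "card ?K = card ((\<lambda>k. k div p) ` ?K)" using inj by (simp add: card_image)
  also have "\<dots> \<le> card {(- X) div p..X div p}" using sub by (intro card_mono) auto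
  finally have "real (card ?K) \<le> real_of_int (X div p) - real_of_int ((- X) div p) + 1"
    using le by simp
  moreover have fl: "\<lfloor>real_of_int k / real_of_int p\<rfloor> = k div p" for k
    by (rule floor_divide_of_int_eq)
  have "real_of_int (X div p) \<le> of_int X / of_int p"
    using floor_correct[of "real_of_int X / real_of_int p"] unfolding fl by linarith
  moreover have "real_of_int ((- X) div p) > of_int (- X) / of_int p - 1"
    using floor_correct[of "real_of_int (- X) / real_of_int p"] unfolding fl by linarith
  ultimately show ?thesis by simp
qed

text \<open>For two points of the parabola described below, \<open>a\<close> and \<open>b\<close>
  are the difference and the sum of their \<open>d\<close>-values, \<open>\<sigma>\<close> is the
  difference of their \<open>s\<close>-values, and \<open>\<tau>\<close> is
  \<open>2 * \<kappa> * \<mu>\<^sup>2\<close>. The bound \<open>2 * L\<close> is what integers from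
  an interval of length \<open>L\<close> allow.\<close>

definition small_products :: "int \<Rightarrow> int \<Rightarrow> (int \<times> int) set"
  where "small_products \<tau> L =
    {(a, b). \<bar>a\<bar> \<le> 2 * L \<and> \<bar>b\<bar> \<le> 2 * L \<and> (\<exists>\<sigma>. \<bar>\<sigma>\<bar> \<le> 2 * L \<and> [a * b = \<tau> * \<sigma>] (mod p))}"

lemma finite_small_products: "finite (small_products \<tau> L)"
  by (rule finite_subset[of _ "{- 2 * L..2 * L} \<times> {- 2 * L..2 * L}"]) (auto simp: small_products_def)

text \<open>For each of the \<open>4 * L + 1\<close> values of \<open>\<sigma>\<close>, the integer
  \<open>a * b\<close> has size at most \<open>4 * L\<^sup>2\<close> and lies in a fixed residue
  class, hence takes at most \<open>8 * L\<^sup>2 / p + 2\<close> values. Each nonzero value has at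
  most \<open>2 * D\<close> factorizations. Product 0 gives the two axes, which are counted by the
  first summand.\<close>

lemma card_small_products_le:
  fixes D :: real
  assumes L: "L \<ge> 1"
    and D: "\<And>n::nat. 0 < n \<Longrightarrow> int n \<le> 4 * L\<^sup>2 \<Longrightarrow> real (card {d. d dvd n}) \<le> D"
  shows "real (card (small_products \<tau> L)) \<le>
    2 * (4 * L + 1) + (4 * L + 1) * (8 * L\<^sup>2 / p + 2) * (2 * D)"
proof -
  define I where "I = {- (2 * L)..2 * L}"
  \<comment> \<open>The value 0 is removed because it has infinitely many factorizations.\<close>
  define K where "K \<sigma> = {k \<in> {- (4 * L\<^sup>2)..4 * L\<^sup>2}. [k = \<tau> * \<sigma>] (mod p)} - {0}" for \<sigma>
  have cI: "real (card I) = 4 * L + 1" "finite I" using L by (auto simp: I_def)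
  have "1 \<le> 4 * L\<^sup>2" using L mult_mono[of 1 L 1 L] by (simp add: power2_eq_square)
  then have "D \<ge> 1" using D[of 1] by simp
  have finK: "finite (K \<sigma>)" for \<sigma>
    by (rule finite_subset[of _ "{- (4 * L\<^sup>2)..4 * L\<^sup>2}"]) (auto simp: K_def)
  have cK: "real (card (K \<sigma>)) \<le> 8 * L\<^sup>2 / p + 2" for \<sigma>
  proof -
    have "card (K \<sigma>) \<le> card {k \<in> {- (4 * L\<^sup>2)..4 * L\<^sup>2}. [k = \<tau> * \<sigma>] (mod p)}"
      unfolding K_def
      by (rule card_mono, rule finite_subset[of _ "{- (4 * L\<^sup>2)..4 * L\<^sup>2}"]) auto
    then show ?thesis using card_residue_class_le[of "4 * L\<^sup>2" "\<tau> * \<sigma>"] by simp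
  qed
  have fib: "real (card {(a, b). a * b = k}) \<le> 2 * D" if "k \<in> K \<sigma>" for k \<sigma>
  proof -
    have "real (card {d. d dvd nat \<bar>k\<bar>}) \<le> D" using that by (intro D) (auto simp: K_def)
    then show ?thesis using card_mult_eq_le(2)[of k] that by (auto simp: K_def)
  qed
  define Q where "Q = (\<Union>\<sigma>\<in>I. \<Union>k\<in>K \<sigma>. {(a, b). a * b = k})"
  have "small_products \<tau> L \<subseteq> {0} \<times> I \<union> I \<times> {0} \<union> Q"
  proof
    fix z assume z: "z \<in> small_products \<tau> L"
    obtain a b where ab: "z = (a, b)" by (cases z)
    with z obtain \<sigma> where s: "\<bar>a\<bar> \<le> 2 * L" "\<bar>b\<bar> \<le> 2 * L" "\<bar>\<sigma>\<bar> \<le> 2 * L" "[a * b = \<tau> * \<sigma>] (mod p)"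
      by (auto simp: small_products_def)
    have "\<bar>a * b\<bar> \<le> (2 * L) * (2 * L)"
      unfolding abs_mult using s L by (intro mult_mono) auto
    then have "\<bar>a * b\<bar> \<le> 4 * L\<^sup>2" by (simp add: power2_eq_square)
    then have "a * b \<noteq> 0 \<Longrightarrow> a * b \<in> K \<sigma>" using s(4) by (auto simp: K_def)
    moreover have I: "\<sigma> \<in> I" "a \<in> I" "b \<in> I" using s by (auto simp: I_def)
    ultimately have "a * b \<noteq> 0 \<Longrightarrow> (a, b) \<in> Q" unfolding Q_def by blast
    then show "z \<in> {0} \<times> I \<union> I \<times> {0} \<union> Q" using ab I by (cases "a * b = 0") auto
  qed
  moreover have "finite Q" unfolding Q_def
  proof (rule finite_UN_I[OF cI(2)], rule finite_UN_I[OF finK])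
    show "finite {(a, b). a * b = k}" if "k \<in> K \<sigma>" for k \<sigma>
      using that by (intro card_mult_eq_le(1)) (simp add: K_def)
  qed
  ultimately have "card (small_products \<tau> L) \<le> card ({0} \<times> I \<union> I \<times> {0} \<union> Q)"
    using cI by (intro card_mono) auto
  also have "\<dots> \<le> card ({0::int} \<times> I) + card (I \<times> {0::int}) + card Q"
    by (meson add_le_mono card_Un_le le_refl order_trans)
  finally have 1: "real (card (small_products \<tau> L)) \<le> 2 * (4 * L + 1) + card Q"
    using cI by (simp add: card_cartesian_product)
  have "card Q \<le> (\<Sum>\<sigma>\<in>I. card (\<Union>k\<in>K \<sigma>. {(a, b). a * b = k}))"
    unfolding Q_def by (rule card_UN_le[OF cI(2)])
  also have "\<dots> \<le> (\<Sum>\<sigma>\<in>I. \<Sum>k\<in>K \<sigma>. card {(a, b). a * b = k})"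
    by (intro sum_mono card_UN_le finK)
  finally have "real (card Q) \<le> real (\<Sum>\<sigma>\<in>I. \<Sum>k\<in>K \<sigma>. card {(a, b). a * b = k})"
    by (rule of_nat_mono)
  also have "\<dots> = (\<Sum>\<sigma>\<in>I. \<Sum>k\<in>K \<sigma>. real (card {(a, b). a * b = k}))" by simp
  also have "\<dots> \<le> (\<Sum>\<sigma>\<in>I. \<Sum>k\<in>K \<sigma>. 2 * D)" by (intro sum_mono fib)
  also have "\<dots> = (\<Sum>\<sigma>\<in>I. card (K \<sigma>) * (2 * D))" by simp
  also have "\<dots> \<le> (\<Sum>\<sigma>\<in>I. (8 * L\<^sup>2 / p + 2) * (2 * D))"
    using \<open>D \<ge> 1\<close> by (intro sum_mono mult_right_mono cK) auto
  also have "\<dots> = (4 * L + 1) * (8 * L\<^sup>2 / p + 2) * (2 * D)" using cI by simp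
  finally show ?thesis using 1 by simp
qed

section \<open>Representations of a residue as a sum of two square roots\<close>

definition roots_of :: "int \<Rightarrow> int set \<Rightarrow> int set"
  where "roots_of \<kappa> A = {u \<in> {0..<p}. \<exists>n\<in>A. [\<kappa> * u\<^sup>2 = n] (mod p)}"

lemma finite_roots_of [simp]: "finite (roots_of \<kappa> A)"
  by (rule finite_subset[of _ "{0..<p}"]) (auto simp: roots_of_def)

lemma roots_of_singleton:
  assumes "\<not> p dvd \<kappa>"
  shows "roots_of \<kappa> {n} = sqroots (modular_inverse p \<kappa> * n)"
proof -
  define \<kappa>' where "\<kappa>' = modular_inverse p \<kappa>"
  have k: "[\<kappa> * \<kappa>' = 1] (mod p)"
    unfolding \<kappa>'_def using assms by (intro cong_modular_inverse1) (simp add: coprime_p)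
  have "[\<kappa> * (\<kappa>' * n) = n] (mod p)" for n
    using cong_mult[OF k cong_refl[of n]] by (simp add: mult_ac)
  then have "[\<kappa> * u\<^sup>2 = n] (mod p) \<longleftrightarrow> [\<kappa> * u\<^sup>2 = \<kappa> * (\<kappa>' * n)] (mod p)" for u
    by (meson cong_sym cong_trans)
  then show ?thesis
    by (simp add: roots_of_def sqroots_def cong_mult_cancel[OF assms] \<kappa>'_def)
qed

lemma roots_of_eq_UN: "roots_of \<kappa> A = (\<Union>n\<in>A. roots_of \<kappa> {n})"
  by (auto simp: roots_of_def)

lemma card_roots_of_le:
  assumes "\<not> p dvd \<kappa>" "finite A"
  shows "card (roots_of \<kappa> A) \<le> 2 * card A"
proof -
  have "card (roots_of \<kappa> A) \<le> (\<Sum>n\<in>A. card (roots_of \<kappa> {n}))"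
    by (subst roots_of_eq_UN) (rule card_UN_le[OF assms(2)])
  also have "\<dots> \<le> (\<Sum>n\<in>A. 2)"
    by (intro sum_mono) (simp add: roots_of_singleton[OF assms(1)] card_sqroots_le)
  finally show ?thesis by simp
qed

definition reps :: "int set \<Rightarrow> int \<Rightarrow> (int \<times> int) set"
  where "reps U \<mu> = {(u, v). u \<in> U \<and> v \<in> U \<and> (u + v) mod p = \<mu>}"

text \<open>The first entry determines the second. This trivial bound serves for the sum 0, which
  the parabola argument below excludes.\<close>

lemma card_reps_le:
  assumes "finite U" "U \<subseteq> {0..<p}"
  shows "card (reps U \<mu>) \<le> card U"
proof (rule card_inj_on_le[of fst])
  show "inj_on fst (reps U \<mu>)"
  proof (rule inj_onI; clarsimp simp: reps_def)
    fix u v v' assume uv: "u \<in> U" "v \<in> U" "v' \<in> U" "(u + v') mod p = (u + v) mod p"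
    then have "[v' = v] (mod p)" by (metis cong_def cong_add_lcancel)
    then show "v = v'" using uv assms residue_eq_iff by blast
  qed
  show "fst ` reps U \<mu> \<subseteq> U" by (auto simp: reps_def)
qed (rule assms)

text \<open>If \<open>\<kappa> u\<^sup>2 = n\<^sub>1\<close>, \<open>\<kappa> v\<^sup>2 = n\<^sub>2\<close> and \<open>u + v = \<mu>\<close>, then
  \<open>d = n\<^sub>1 - n\<^sub>2\<close> and \<open>s = n\<^sub>1 + n\<^sub>2\<close> satisfy \<open>d = \<kappa> \<mu> (u - v)\<close> and
  \<open>d\<^sup>2 = 2 \<kappa> \<mu>\<^sup>2 s - \<kappa>\<^sup>2 \<mu>\<^sup>4\<close>. Two points of this parabola give a small product
  \<open>(d - d')(d + d') = 2 \<kappa> \<mu>\<^sup>2 (s - s')\<close>.\<close>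

lemma card_reps_square_le:
  assumes \<kappa>: "\<not> p dvd \<kappa>" and \<mu>: "\<not> p dvd \<mu>"
    and A: "\<And>a b. a \<in> A \<Longrightarrow> b \<in> A \<Longrightarrow> \<bar>a - b\<bar> \<le> L"
  shows "card (reps (roots_of \<kappa> A) \<mu>) ^ 2 \<le> card (small_products (2 * \<kappa> * \<mu>\<^sup>2) L)"
proof -
  define R where "R = reps (roots_of \<kappa> A) \<mu>"
  \<comment> \<open>An integer of \<open>A\<close> with root \<open>u\<close>, fixed by choice. The
    size bounds concern these integers, not their residues.\<close>
  define \<nu> where "\<nu> u = (SOME n. n \<in> A \<and> [\<kappa> * u\<^sup>2 = n] (mod p))" for u
  have \<nu>: "\<nu> u \<in> A" "[\<kappa> * u\<^sup>2 = \<nu> u] (mod p)" if "u \<in> roots_of \<kappa> A" for u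
    using someI_ex[of "\<lambda>n. n \<in> A \<and> [\<kappa> * u\<^sup>2 = n] (mod p)"] that
    by (auto simp: \<nu>_def roots_of_def)
  define d where "d = (\<lambda>(u, v). \<nu> u - \<nu> v)"
  define s where "s = (\<lambda>(u, v). \<nu> u + \<nu> v)"
  define \<Phi> where "\<Phi> = (\<lambda>(x, y). (d x - d y, d x + d y))"
  have d: "[d x = \<kappa> * \<mu> * (2 * fst x - \<mu>)] (mod p)"
    and ds: "[(d x)\<^sup>2 = 2 * \<kappa> * \<mu>\<^sup>2 * s x - \<kappa>\<^sup>2 * \<mu> ^ 4] (mod p)"
    and dL: "\<bar>d x\<bar> \<le> L" if "x \<in> R" for x
  proof -
    obtain u v where x: "x = (u, v)" by (cases x)
    have uv: "u \<in> roots_of \<kappa> A" "v \<in> roots_of \<kappa> A" "(u + v) mod p = \<mu>"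
      using that by (auto simp: R_def reps_def x)
    have "[u + v = \<mu>] (mod p)" using uv(3) by (metis cong_def mod_mod_trivial)
    then have l: "[v = \<mu> - u] (mod p)" by (simp add: cong_iff_dvd_diff algebra_simps)
    have d': "[d x = \<kappa> * u\<^sup>2 - \<kappa> * v\<^sup>2] (mod p)" and s': "[s x = \<kappa> * u\<^sup>2 + \<kappa> * v\<^sup>2] (mod p)"
      using cong_sym[OF \<nu>(2)[OF uv(1)]] cong_sym[OF \<nu>(2)[OF uv(2)]]
      by (auto simp: x d_def s_def intro: cong_diff cong_add)
    have v2: "[\<kappa> * v\<^sup>2 = \<kappa> * (\<mu> - u)\<^sup>2] (mod p)" by (intro cong_mult cong_pow l cong_refl)
    have "[d x = \<kappa> * u\<^sup>2 - \<kappa> * (\<mu> - u)\<^sup>2] (mod p)"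
      by (rule cong_trans[OF d']) (intro cong_diff v2 cong_refl)
    also have "\<kappa> * u\<^sup>2 - \<kappa> * (\<mu> - u)\<^sup>2 = \<kappa> * \<mu> * (2 * fst x - \<mu>)"
      by (simp add: x power2_eq_square algebra_simps)
    finally show dx: "[d x = \<kappa> * \<mu> * (2 * fst x - \<mu>)] (mod p)" .
    have s'': "[s x = \<kappa> * u\<^sup>2 + \<kappa> * (\<mu> - u)\<^sup>2] (mod p)"
      by (rule cong_trans[OF s']) (intro cong_add v2 cong_refl)
    have "[(d x)\<^sup>2 = (\<kappa> * \<mu> * (2 * fst x - \<mu>))\<^sup>2] (mod p)" by (intro cong_pow dx)
    \<comment> \<open>The parallelogram identity \<open>(u - v)\<^sup>2 = 2 * (u\<^sup>2 +
      v\<^sup>2) - (u + v)\<^sup>2\<close>, multiplied by \<open>(\<kappa> * \<mu>)\<^sup>2\<close>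
      and read with \<open>v = \<mu> - u\<close>.\<close>
    also have "(\<kappa> * \<mu> * (2 * fst x - \<mu>))\<^sup>2 =
        2 * \<kappa> * \<mu>\<^sup>2 * (\<kappa> * u\<^sup>2 + \<kappa> * (\<mu> - u)\<^sup>2) - \<kappa>\<^sup>2 * \<mu> ^ 4"
      by (simp add: x power2_eq_square power4_eq_xxxx algebra_simps)
    also have "[\<dots> = 2 * \<kappa> * \<mu>\<^sup>2 * s x - \<kappa>\<^sup>2 * \<mu> ^ 4] (mod p)"
      by (intro cong_diff cong_mult cong_refl cong_sym[OF s''])
    finally show "[(d x)\<^sup>2 = 2 * \<kappa> * \<mu>\<^sup>2 * s x - \<kappa>\<^sup>2 * \<mu> ^ 4] (mod p)" .
    show "\<bar>d x\<bar> \<le> L" using A \<nu>(1) uv by (simp add: x d_def)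
  qed
  have sL: "\<bar>s x - s y\<bar> \<le> 2 * L" if "x \<in> R" "y \<in> R" for x y
  proof -
    obtain u v u' v' where xy: "x = (u, v)" "y = (u', v')" by (cases x; cases y)
    have "\<nu> u \<in> A" "\<nu> v \<in> A" "\<nu> u' \<in> A" "\<nu> v' \<in> A"
      using that \<nu>(1) by (auto simp: R_def reps_def xy)
    then have "\<bar>\<nu> u - \<nu> u'\<bar> \<le> L" "\<bar>\<nu> v - \<nu> v'\<bar> \<le> L" using A by auto
    then show ?thesis by (simp add: xy s_def)
  qed
  \<comment> \<open>Modulo \<open>p\<close>, \<open>d\<close> is an affine function of the first
    entry with slope \<open>2 * \<kappa> * \<mu>\<close>, a unit; the second entry then follows from
    the sum.\<close>
  have inj_d: "x = y" if "x \<in> R" "y \<in> R" "d x = d y" for x y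
  proof -
    obtain u v u' v' where xy: "x = (u, v)" "y = (u', v')" by (cases x; cases y)
    have r: "u \<in> {0..<p}" "v \<in> {0..<p}" "u' \<in> {0..<p}" "v' \<in> {0..<p}"
      "(u + v) mod p = (u' + v') mod p"
      using that by (auto simp: R_def reps_def roots_of_def xy)
    have "[\<kappa> * \<mu> * (2 * u - \<mu>) = \<kappa> * \<mu> * (2 * u' - \<mu>)] (mod p)"
      using d[OF that(1)] d[OF that(2)] that(3) by (metis cong_sym cong_trans fst_conv xy)
    moreover have "\<not> p dvd \<kappa> * \<mu>" using \<kappa> \<mu> prime_p by (simp add: prime_dvd_mult_iff)
    ultimately have "[2 * u - \<mu> = 2 * u' - \<mu>] (mod p)" by (simp add: cong_mult_cancel)
    then have "[2 * u = 2 * u'] (mod p)" by (simp add: cong_iff_dvd_diff)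
    then have "u = u'" using cong_mult_cancel[OF not_dvd_2] residue_eq_iff r by blast
    moreover from this have "v = v'"
      using r by (metis cong_add_lcancel cong_def residue_eq_iff)
    ultimately show ?thesis by (simp add: xy)
  qed
  have "card (R \<times> R) \<le> card (small_products (2 * \<kappa> * \<mu>\<^sup>2) L)"
  proof (rule card_inj_on_le[of \<Phi>])
    show "inj_on \<Phi> (R \<times> R)"
    proof (rule inj_onI)
      fix z w assume zw: "z \<in> R \<times> R" "w \<in> R \<times> R" and eq: "\<Phi> z = \<Phi> w"
      \<comment> \<open>Difference and sum together recover both values of \<open>d\<close>.\<close>
      have "d (fst z) = d (fst w)" "d (snd z) = d (snd w)"
        using eq by (auto simp: \<Phi>_def case_prod_beta)
      then have "fst z = fst w" "snd z = snd w" using zw by (auto intro!: inj_d)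
      then show "z = w" by (rule prod_eqI)
    qed
    show "\<Phi> ` (R \<times> R) \<subseteq> small_products (2 * \<kappa> * \<mu>\<^sup>2) L"
    proof (rule image_subsetI)
      fix z assume "z \<in> R \<times> R"
      then obtain x y where z: "z = (x, y)" and xy: "x \<in> R" "y \<in> R" by auto
      have "[(d x)\<^sup>2 - (d y)\<^sup>2 = (2 * \<kappa> * \<mu>\<^sup>2 * s x - \<kappa>\<^sup>2 * \<mu> ^ 4) - (2 * \<kappa> * \<mu>\<^sup>2 * s y - \<kappa>\<^sup>2 * \<mu> ^ 4)] (mod p)"
        by (intro cong_diff ds xy)
      then have "[(d x - d y) * (d x + d y) = 2 * \<kappa> * \<mu>\<^sup>2 * (s x - s y)] (mod p)"
        by (simp add: power2_eq_square algebra_simps)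
      moreover have "\<bar>d x - d y\<bar> \<le> 2 * L" "\<bar>d x + d y\<bar> \<le> 2 * L" using dL[OF xy(1)] dL[OF xy(2)] by linarith+
      ultimately show "\<Phi> z \<in> small_products (2 * \<kappa> * \<mu>\<^sup>2) L"
        using sL[OF xy] by (auto simp: small_products_def \<Phi>_def z)
    qed
  qed (rule finite_small_products)
  then show ?thesis by (simp add: R_def card_cartesian_product power2_eq_square)
qed

end

section \<open>Correlations of sums over square roots\<close>

lemma sum_inj_le:
  fixes f :: "'b \<Rightarrow> real"
  assumes "inj_on \<rho> A" "\<rho> ` A \<subseteq> U" "finite U" "\<And>u. f u \<ge> 0"
  shows "(\<Sum>a\<in>A. f (\<rho> a)) \<le> (\<Sum>u\<in>U. f u)"
proof -
  have "(\<Sum>a\<in>A. f (\<rho> a)) = sum f (\<rho> ` A)" by (simp add: sum.reindex[OF assms(1)])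
  also have "\<dots> \<le> sum f U" using assms by (intro sum_mono2) auto
  finally show ?thesis .
qed

context odd_prime
begin

section \<open>Exponential sums over sets of residues\<close>

definition exp_sum :: "int set \<Rightarrow> int \<Rightarrow> complex"
  where "exp_sum V l = (\<Sum>v\<in>V. e (v * l))"

lemma exp_sum_mod [simp]: "exp_sum V (l mod p) = exp_sum V l"
  unfolding exp_sum_def by (intro sum.cong refl e_cong) (simp add: cong_def mod_mult_right_eq)

lemma parseval:
  assumes "V \<subseteq> {0..<p}" "\<not> p dvd \<kappa>"
  shows "(\<Sum>l\<in>{0..<p}. (norm (exp_sum V (\<kappa> * l)))\<^sup>2) = real_of_int p * real (card V)"
proof -
  have fin: "finite V" using assms(1) finite_subset by blast
  have "complex_of_real (\<Sum>l\<in>{0..<p}. (norm (exp_sum V (\<kappa> * l)))\<^sup>2) =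
      (\<Sum>l\<in>{0..<p}. exp_sum V (\<kappa> * l) * cnj (exp_sum V (\<kappa> * l)))"
    by (simp only: of_real_sum complex_norm_square)
  also have "\<dots> = (\<Sum>l\<in>{0..<p}. \<Sum>v\<in>V. \<Sum>w\<in>V. e ((v - w) * \<kappa> * l))"
    unfolding exp_sum_def cnj_sum sum_product
    by (intro sum.cong refl) (simp add: cnj_e algebra_simps flip: e_add)
  also have "\<dots> = (\<Sum>v\<in>V. \<Sum>l\<in>{0..<p}. \<Sum>w\<in>V. e ((v - w) * \<kappa> * l))"
    by (rule sum.swap)
  also have "\<dots> = (\<Sum>v\<in>V. \<Sum>w\<in>V. \<Sum>l\<in>{0..<p}. e ((v - w) * \<kappa> * l))"
    by (intro sum.cong refl sum.swap)
  also have "\<dots> = (\<Sum>v\<in>V. \<Sum>w\<in>V. if v = w then of_int p else 0)"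
  proof (intro sum.cong refl)
    fix v w assume "v \<in> V" "w \<in> V"
    then have "v \<in> {0..<p}" "w \<in> {0..<p}" using assms(1) by blast+
    then have "p dvd v - w \<longleftrightarrow> v = w"
      using residue_eq_iff[of v w] by (simp add: cong_iff_dvd_diff)
    then show "(\<Sum>l\<in>{0..<p}. e ((v - w) * \<kappa> * l)) = (if v = w then of_int p else 0)"
      using assms(2) prime_p by (simp add: sum_e prime_dvd_mult_iff)
  qed
  also have "\<dots> = complex_of_real (real_of_int p * real (card V))" using fin by simp
  finally show ?thesis using of_real_eq_iff by blast
qed

text \<open>The square of \<open>2 * \<kappa> * u * v\<close> is
  \<open>4 * (\<kappa> * u\<^sup>2) * (\<kappa> * v\<^sup>2)\<close>, and the first bracket is
  congruent to \<open>n\<close>. Cancelling units, it is congruent to \<open>4 * a * n\<close>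
  exactly when \<open>\<kappa> * v\<^sup>2\<close> is congruent to \<open>a\<close>.\<close>

lemma bij_betw_roots_of_sqroots:
  assumes \<kappa>: "\<not> p dvd \<kappa>" and n: "\<not> p dvd n" and u: "[\<kappa> * u\<^sup>2 = n] (mod p)"
  shows "bij_betw (\<lambda>v. (2 * \<kappa> * u * v) mod p) (roots_of \<kappa> {a}) (sqroots (4 * a * n))"
proof -
  have "\<not> p dvd \<kappa> * u\<^sup>2" using u n by (metis cong_dvd_iff)
  then have nd: "\<not> p dvd 2 * \<kappa> * u" "\<not> p dvd 4 * (\<kappa> * u\<^sup>2)"
    using prime_p not_dvd_2 not_dvd_4 by (auto simp: prime_dvd_mult_iff power2_eq_square)
  have bij: "bij_betw (\<lambda>v. (2 * \<kappa> * u * v) mod p) {0..<p} {0..<p}"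
    using affine_bij_betw[OF nd(1), of 0] by simp
  have iff: "v \<in> roots_of \<kappa> {a} \<longleftrightarrow> (2 * \<kappa> * u * v) mod p \<in> sqroots (4 * a * n)" if "v \<in> {0..<p}" for v
  proof -
    have "[4 * a * n = 4 * (\<kappa> * u\<^sup>2) * a] (mod p)"
      using cong_mult[OF cong_refl[of "4 * a"] cong_sym[OF u]] by (simp add: mult_ac)
    then have "[((2 * \<kappa> * u * v) mod p)\<^sup>2 = 4 * a * n] (mod p) \<longleftrightarrow>
        [(2 * \<kappa> * u * v)\<^sup>2 = 4 * (\<kappa> * u\<^sup>2) * a] (mod p)"
      by (simp add: cong_def power_mod)
    also have "(2 * \<kappa> * u * v)\<^sup>2 = 4 * (\<kappa> * u\<^sup>2) * (\<kappa> * v\<^sup>2)"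
      by (simp add: power2_eq_square)
    finally show ?thesis
      using that p_pos by (simp add: cong_mult_cancel[OF nd(2)] roots_of_def sqroots_def)
  qed
  have "(\<lambda>v. (2 * \<kappa> * u * v) mod p) ` roots_of \<kappa> {a} = sqroots (4 * a * n)"
  proof (intro equalityI subsetI)
    fix y assume "y \<in> (\<lambda>v. (2 * \<kappa> * u * v) mod p) ` roots_of \<kappa> {a}"
    then show "y \<in> sqroots (4 * a * n)" using iff by (auto simp: roots_of_def)
  next
    fix y assume y: "y \<in> sqroots (4 * a * n)"
    then have "y \<in> (\<lambda>v. (2 * \<kappa> * u * v) mod p) ` {0..<p}"
      using bij_betw_imp_surj_on[OF bij] by (simp add: sqroots_def)
    then obtain v where "v \<in> {0..<p}" "y = (2 * \<kappa> * u * v) mod p" by blast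
    with y iff show "y \<in> (\<lambda>v. (2 * \<kappa> * u * v) mod p) ` roots_of \<kappa> {a}" by blast
  qed
  moreover have "inj_on (\<lambda>v. (2 * \<kappa> * u * v) mod p) (roots_of \<kappa> {a})"
    using bij by (rule inj_on_subset[OF bij_betw_imp_inj_on]) (auto simp: roots_of_def)
  ultimately show ?thesis by (simp add: bij_betw_def)
qed

text \<open>Separation of variables: \<open>u\<close> depends only on \<open>n\<close>, and the set
  of the \<open>v\<close> only on \<open>c * m\<close>.\<close>

lemma root_sum_eq:
  assumes "\<not> p dvd \<kappa>" "\<not> p dvd n" "[\<kappa> * u\<^sup>2 = n] (mod p)"
  shows "root_sum (c * n) m = (\<Sum>v\<in>roots_of \<kappa> {c * m}. e (2 * \<kappa> * u * v))"
proof -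
  have "root_sum (c * n) m = (\<Sum>y\<in>sqroots (4 * (c * m) * n). e y)"
    by (simp add: root_sum_def mult_ac)
  also have "\<dots> = (\<Sum>v\<in>roots_of \<kappa> {c * m}. e ((2 * \<kappa> * u * v) mod p))"
    by (rule sum.reindex_bij_betw[OF bij_betw_roots_of_sqroots[OF assms], symmetric])
  finally show ?thesis by simp
qed

text \<open>The roots over a fixed \<open>c * m\<close> are \<open>v\<close> and its negative. In
  the double sum over two such roots, equal ones give the frequency with \<open>u1 - u2\<close>,
  opposite ones that with \<open>u1 + u2\<close>.\<close>

lemma root_sum_mult_cnj:
  assumes \<kappa>: "\<not> p dvd \<kappa>" and n: "\<not> p dvd n1" "\<not> p dvd n2" and cm: "\<not> p dvd c * m"
    and u: "[\<kappa> * u1\<^sup>2 = n1] (mod p)" "[\<kappa> * u2\<^sup>2 = n2] (mod p)"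
  shows "root_sum (c * n1) m * cnj (root_sum (c * n2) m) =
    (\<Sum>v\<in>roots_of \<kappa> {c * m}. e (v * (2 * \<kappa> * (u1 - u2))) + e (v * (2 * \<kappa> * (u1 + u2))))"
proof -
  let ?T = "roots_of \<kappa> {c * m}"
  define \<kappa>' where "\<kappa>' = modular_inverse p \<kappa>"
  have "coprime \<kappa>' p" unfolding \<kappa>'_def using \<kappa> by (intro coprime_modular_inverse) (simp add: coprime_p)
  then have nd: "\<not> p dvd \<kappa>' * (c * m)" using cm prime_p by (simp add: coprime_p prime_dvd_mult_iff)
  have T: "?T = sqroots (\<kappa>' * (c * m))" using roots_of_singleton[OF \<kappa>] by (simp add: \<kappa>'_def)
  have neg: "(\<Sum>w\<in>?T. e (- (2 * \<kappa> * u2 * w))) = e (- (2 * \<kappa> * u2 * v)) + e (2 * \<kappa> * u2 * v)"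
    if "v \<in> ?T" for v
  proof -
    have v: "?T = {v, p - v}" "v \<noteq> p - v" using sqroots_eq[OF _ nd] that unfolding T by auto
    have "e (- (2 * \<kappa> * u2 * (p - v))) = e (2 * \<kappa> * u2 * v)"
      by (rule e_cong) (simp add: cong_iff_dvd_diff algebra_simps)
    then show ?thesis using v(2) by (simp add: v(1))
  qed
  have "root_sum (c * n1) m * cnj (root_sum (c * n2) m) =
      (\<Sum>v\<in>?T. e (2 * \<kappa> * u1 * v) * (\<Sum>w\<in>?T. e (- (2 * \<kappa> * u2 * w))))"
    unfolding root_sum_eq[OF \<kappa> n(1) u(1)] root_sum_eq[OF \<kappa> n(2) u(2)]
    by (simp add: cnj_e sum_distrib_right)
  also have "\<dots> = (\<Sum>v\<in>?T. e (v * (2 * \<kappa> * (u1 - u2))) + e (v * (2 * \<kappa> * (u1 + u2))))"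
  proof (intro sum.cong refl)
    fix v assume v: "v \<in> ?T"
    show "e (2 * \<kappa> * u1 * v) * (\<Sum>w\<in>?T. e (- (2 * \<kappa> * u2 * w))) =
        e (v * (2 * \<kappa> * (u1 - u2))) + e (v * (2 * \<kappa> * (u1 + u2)))"
      unfolding neg[OF v] by (simp add: algebra_simps flip: e_add)
  qed
  finally show ?thesis .
qed

text \<open>Since \<open>c\<close> is invertible, distinct \<open>m\<close> in
  \<open>{1..<p}\<close> have disjoint root sets. The sum over \<open>m\<close> therefore merges
  into exponential sums over the single set \<open>V\<close>, which does not depend on
  \<open>u1\<close> and \<open>u2\<close>.\<close>

lemma sum_root_sum_mult_cnj:
  assumes \<kappa>: "\<not> p dvd \<kappa>" and n: "\<not> p dvd n1" "\<not> p dvd n2" and c: "\<not> p dvd c" and B: "B \<subseteq> {1..<p}"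
    and u: "[\<kappa> * u1\<^sup>2 = n1] (mod p)" "[\<kappa> * u2\<^sup>2 = n2] (mod p)"
  defines "V \<equiv> roots_of \<kappa> ((*) c ` B)"
  shows "(\<Sum>m\<in>B. root_sum (c * n1) m * cnj (root_sum (c * n2) m)) =
    exp_sum V (2 * \<kappa> * (u1 - u2)) + exp_sum V (2 * \<kappa> * (u1 + u2))"
proof -
  have finB: "finite B" using B finite_subset by blast
  have cm: "\<not> p dvd c * m" if "m \<in> B" for m
    using B c prime_p that by (auto simp: prime_dvd_mult_iff zdvd_not_zless)
  have disj: "roots_of \<kappa> {c * m} \<inter> roots_of \<kappa> {c * m'} = {}" if "m \<in> B" "m' \<in> B" "m \<noteq> m'" for m m'
  proof (rule ccontr)
    assume "roots_of \<kappa> {c * m} \<inter> roots_of \<kappa> {c * m'} \<noteq> {}"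
    then have "[c * m = c * m'] (mod p)"
      by (auto simp: roots_of_def) (metis cong_sym cong_trans)
    moreover have "m \<in> {0..<p}" "m' \<in> {0..<p}" using that(1,2) B by force+
    ultimately show False using that(3) c residue_eq_iff by (simp add: cong_mult_cancel)
  qed
  have V: "V = (\<Union>m\<in>B. roots_of \<kappa> {c * m})" by (auto simp: V_def roots_of_def)
  have "(\<Sum>m\<in>B. root_sum (c * n1) m * cnj (root_sum (c * n2) m)) =
      (\<Sum>m\<in>B. \<Sum>v\<in>roots_of \<kappa> {c * m}. e (v * (2 * \<kappa> * (u1 - u2))) + e (v * (2 * \<kappa> * (u1 + u2))))"
    using root_sum_mult_cnj[OF \<kappa> n cm u] by (intro sum.cong refl)
  also have "\<dots> = (\<Sum>v\<in>V. e (v * (2 * \<kappa> * (u1 - u2))) + e (v * (2 * \<kappa> * (u1 + u2))))"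
    unfolding V using finB disj by (intro sum.UNION_disjoint[symmetric]) auto
  finally show ?thesis by (simp add: exp_sum_def sum.distrib)
qed

text \<open>Group the pairs by \<open>l = u + v\<close> and apply Cauchy-Schwarz, with Parseval for
  the exponential sums. The squared multiplicities add up to the additive energy of
  \<open>U\<close>: \<open>l = 0\<close> contributes at most the square of \<open>card U\<close>,
  the other \<open>l\<close> at most \<open>K\<close> times the number of pairs.\<close>

lemma sum_pairs_exp_sum_le:
  assumes U: "U \<subseteq> {0..<p}" and V: "V \<subseteq> {0..<p}" and \<kappa>: "\<not> p dvd \<kappa>"
    and K: "K \<ge> 0" "\<And>l. \<not> p dvd l \<Longrightarrow> real (card (reps U l)) \<le> K"
  shows "(\<Sum>u\<in>U. \<Sum>v\<in>U. norm (exp_sum V (\<kappa> * (u + v)))) \<le>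
    real (card U) * sqrt (1 + K) * sqrt (real_of_int p * real (card V))"
proof -
  have finU: "finite U" using U finite_subset by blast
  define r where "r l = real (card (reps U l))" for l
  have part: "(\<Sum>x\<in>U \<times> U. g ((fst x + snd x) mod p)) = (\<Sum>l\<in>{0..<p}. r l * g l)"
    for g :: "int \<Rightarrow> real"
  proof -
    have "(\<Sum>x\<in>U \<times> U. g ((fst x + snd x) mod p)) =
        (\<Sum>l\<in>{0..<p}. \<Sum>x | x \<in> U \<times> U \<and> (fst x + snd x) mod p = l. g ((fst x + snd x) mod p))"
      using finU p_pos by (intro sum.group[symmetric]) auto
    also have "\<dots> = (\<Sum>l\<in>{0..<p}. \<Sum>x\<in>reps U l. g l)"
      by (intro sum.cong) (auto simp: reps_def)
    finally show ?thesis by (simp add: r_def)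
  qed
  have "(\<Sum>u\<in>U. \<Sum>v\<in>U. norm (exp_sum V (\<kappa> * (u + v)))) =
      (\<Sum>x\<in>U \<times> U. norm (exp_sum V (\<kappa> * ((fst x + snd x) mod p))))"
  proof -
    have "exp_sum V (\<kappa> * (l mod p)) = exp_sum V (\<kappa> * l)" for l
      by (metis exp_sum_mod mod_mult_right_eq)
    then show ?thesis by (simp add: sum.cartesian_product case_prod_beta)
  qed
  also have "\<dots> = (\<Sum>l\<in>{0..<p}. r l * norm (exp_sum V (\<kappa> * l)))"
    by (rule part[of "\<lambda>l. norm (exp_sum V (\<kappa> * l))"])
  also have "\<dots> \<le> sqrt ((\<Sum>l\<in>{0..<p}. (r l)\<^sup>2) * (\<Sum>l\<in>{0..<p}. (norm (exp_sum V (\<kappa> * l)))\<^sup>2))"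
    by (intro real_le_rsqrt Cauchy_Schwarz_ineq_sum)
  also have "\<dots> \<le> sqrt (((real (card U))\<^sup>2 * (1 + K)) * (real_of_int p * real (card V)))"
  proof -
    have "(\<Sum>l\<in>{0..<p}. (r l)\<^sup>2) \<le> (\<Sum>l\<in>{0..<p}. (if l = 0 then (real (card U))\<^sup>2 else 0) + K * r l)"
    proof (rule sum_mono)
      fix l assume l: "l \<in> {0..<p}"
      show "(r l)\<^sup>2 \<le> (if l = 0 then (real (card U))\<^sup>2 else 0) + K * r l"
      proof (cases "l = 0")
        case True
        have "(r l)\<^sup>2 \<le> (real (card U))\<^sup>2"
          using card_reps_le[OF finU U, of l] by (intro power_mono) (auto simp: r_def)
        moreover have "K * r l \<ge> 0" using K by (simp add: r_def)
        ultimately show ?thesis using True by simp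
      next
        case False
        then have "\<not> p dvd l" using l by (auto simp: zdvd_not_zless)
        then have "r l * r l \<le> K * r l" using K by (intro mult_right_mono) (auto simp: r_def)
        then show ?thesis using False by (simp add: power2_eq_square)
      qed
    qed
    also have "\<dots> = (real (card U))\<^sup>2 + K * (\<Sum>l\<in>{0..<p}. r l * 1)"
      using p_pos by (simp add: sum.distrib sum_distrib_left)
    also have "(\<Sum>l\<in>{0..<p}. r l * 1) = (real (card U))\<^sup>2"
      unfolding part[of "\<lambda>_. 1", symmetric] by (simp add: card_cartesian_product power2_eq_square)
    finally have E: "(\<Sum>l\<in>{0..<p}. (r l)\<^sup>2) \<le> (real (card U))\<^sup>2 * (1 + K)" by (simp add: algebra_simps)
    show ?thesis unfolding parseval[OF V \<kappa>]
      by (intro real_sqrt_le_mono mult_right_mono E) (use p_pos in auto)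
  qed
  also have "\<dots> = real (card U) * sqrt (1 + K) * sqrt (real_of_int p * real (card V))"
    by (simp add: real_sqrt_mult)
  finally show ?thesis .
qed

text \<open>The negative of a root is a root, so the frequency with \<open>u1 - u2\<close> also
  comes from a sum of two roots, and both parts of the correlation are dominated by the same double
  sum over \<open>U\<close>. The factor 4 is 2 for the two parts times 2 for the roots per element
  of \<open>A\<close>.\<close>

lemma sum_root_sum_class_le:
  assumes \<kappa>: "\<not> p dvd \<kappa>" and c: "\<not> p dvd c" and B: "B \<subseteq> {1..<p}" and A: "A \<subseteq> {1..<p}"
    and AL: "\<And>a b. a \<in> A \<Longrightarrow> b \<in> A \<Longrightarrow> \<bar>a - b\<bar> \<le> L"
    and K: "K \<ge> 0" "\<And>\<tau>. real (card (small_products \<tau> L)) \<le> K\<^sup>2"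
  defines "A' \<equiv> {n \<in> A. \<exists>u\<in>{0..<p}. [\<kappa> * u\<^sup>2 = n] (mod p)}"
  shows "(\<Sum>n1\<in>A'. \<Sum>n2\<in>A'. norm (\<Sum>m\<in>B. root_sum (c * n1) m * cnj (root_sum (c * n2) m))) \<le>
    4 * real (card A) * sqrt (1 + K) * sqrt (real_of_int p * (2 * real (card B)))"
proof -
  define U where "U = roots_of \<kappa> A"
  define V where "V = roots_of \<kappa> ((*) c ` B)"
  define \<rho> where "\<rho> n = (SOME u. u \<in> {0..<p} \<and> [\<kappa> * u\<^sup>2 = n] (mod p))" for n
  define \<rho>' where "\<rho>' n = (- \<rho> n) mod p" for n
  have fin: "finite A" "finite B" using A B finite_subset by blast+
  have \<rho>: "\<rho> n \<in> {0..<p}" "[\<kappa> * (\<rho> n)\<^sup>2 = n] (mod p)" if "n \<in> A'" for n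
  proof -
    have "\<exists>u. u \<in> {0..<p} \<and> [\<kappa> * u\<^sup>2 = n] (mod p)" using that unfolding A'_def by blast
    from someI_ex[OF this] show "\<rho> n \<in> {0..<p}" "[\<kappa> * (\<rho> n)\<^sup>2 = n] (mod p)"
      unfolding \<rho>_def by blast+
  qed
  have \<rho>': "\<rho>' n \<in> {0..<p}" "[\<kappa> * (\<rho>' n)\<^sup>2 = n] (mod p)" if "n \<in> A'" for n
  proof -
    show "\<rho>' n \<in> {0..<p}" using p_pos by (simp add: \<rho>'_def)
    have "[\<kappa> * (\<rho>' n)\<^sup>2 = \<kappa> * (- \<rho> n)\<^sup>2] (mod p)"
      unfolding \<rho>'_def by (intro cong_mult cong_pow) (auto simp: cong_def)
    then show "[\<kappa> * (\<rho>' n)\<^sup>2 = n] (mod p)" using \<rho>(2)[OF that] by (simp add: cong_def)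
  qed
  have sub: "A' \<subseteq> A" by (auto simp: A'_def)
  have inj: "inj_on f A'" if "\<And>n. n \<in> A' \<Longrightarrow> [\<kappa> * (f n)\<^sup>2 = n] (mod p)" for f
  proof (rule inj_onI)
    fix a b assume ab: "a \<in> A'" "b \<in> A'" "f a = f b"
    then have "[a = b] (mod p)" using that by (metis cong_sym cong_trans)
    moreover have "a \<in> {0..<p}" "b \<in> {0..<p}" using ab sub A by force+
    ultimately show "a = b" using residue_eq_iff by blast
  qed
  have img: "\<rho> ` A' \<subseteq> U" "\<rho>' ` A' \<subseteq> U"
    using \<rho> \<rho>' sub unfolding U_def roots_of_def by blast+
  have finU: "finite U" by (simp add: U_def)
  have ndA: "\<not> p dvd n" if "n \<in> A'" for n using that sub A by (auto simp: zdvd_not_zless)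
  define W where "W = (\<Sum>u\<in>U. \<Sum>v\<in>U. norm (exp_sum V (2 * \<kappa> * (u + v))))"
  have two: "(\<Sum>n1\<in>A'. \<Sum>n2\<in>A'. norm (exp_sum V (2 * \<kappa> * (\<rho> n1 + f n2)))) \<le> W"
    if "inj_on f A'" "f ` A' \<subseteq> U" for f
  proof -
    have "(\<Sum>n1\<in>A'. \<Sum>n2\<in>A'. norm (exp_sum V (2 * \<kappa> * (\<rho> n1 + f n2)))) \<le>
        (\<Sum>n1\<in>A'. \<Sum>v\<in>U. norm (exp_sum V (2 * \<kappa> * (\<rho> n1 + v))))"
      by (intro sum_mono sum_inj_le that finU) auto
    also have "\<dots> \<le> W" unfolding W_def
      by (rule sum_inj_le[OF inj img(1) finU]) (auto intro: \<rho>(2) sum_nonneg)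
    finally show ?thesis .
  qed
  have "(\<Sum>n1\<in>A'. \<Sum>n2\<in>A'. norm (\<Sum>m\<in>B. root_sum (c * n1) m * cnj (root_sum (c * n2) m))) \<le>
      (\<Sum>n1\<in>A'. \<Sum>n2\<in>A'. norm (exp_sum V (2 * \<kappa> * (\<rho> n1 + \<rho>' n2))) +
        norm (exp_sum V (2 * \<kappa> * (\<rho> n1 + \<rho> n2))))"
  proof (intro sum_mono)
    fix n1 n2 assume n: "n1 \<in> A'" "n2 \<in> A'"
    have "[2 * \<kappa> * (\<rho> n1 + \<rho>' n2) = 2 * \<kappa> * (\<rho> n1 - \<rho> n2)] (mod p)"
      by (intro cong_mult cong_refl) (simp add: \<rho>'_def cong_def mod_add_right_eq)
    then have "exp_sum V (2 * \<kappa> * (\<rho> n1 + \<rho>' n2)) = exp_sum V (2 * \<kappa> * (\<rho> n1 - \<rho> n2))"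
      by (metis cong_def exp_sum_mod)
    moreover have "(\<Sum>m\<in>B. root_sum (c * n1) m * cnj (root_sum (c * n2) m)) =
        exp_sum V (2 * \<kappa> * (\<rho> n1 - \<rho> n2)) + exp_sum V (2 * \<kappa> * (\<rho> n1 + \<rho> n2))"
      unfolding V_def using n
      by (intro sum_root_sum_mult_cnj[OF \<kappa> _ _ c B]) (auto intro: \<rho>(2) dest: ndA)
    ultimately show "norm (\<Sum>m\<in>B. root_sum (c * n1) m * cnj (root_sum (c * n2) m)) \<le>
        norm (exp_sum V (2 * \<kappa> * (\<rho> n1 + \<rho>' n2))) + norm (exp_sum V (2 * \<kappa> * (\<rho> n1 + \<rho> n2)))"
      by (simp add: norm_triangle_ineq)
  qed
  also have "\<dots> \<le> 2 * W"
    using two[OF inj[OF \<rho>(2)] img(1)] two[OF inj[OF \<rho>'(2)] img(2)]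
    by (simp add: sum.distrib)
  also have "W \<le> real (card U) * sqrt (1 + K) * sqrt (real_of_int p * real (card V))"
    unfolding W_def
  proof (rule sum_pairs_exp_sum_le)
    show "U \<subseteq> {0..<p}" "V \<subseteq> {0..<p}" by (auto simp: U_def V_def roots_of_def)
    show "\<not> p dvd 2 * \<kappa>" using \<kappa> not_dvd_2 prime_p by (simp add: prime_dvd_mult_iff)
    show "real (card (reps U l)) \<le> K" if "\<not> p dvd l" for l
    proof -
      have "real (card (reps U l) ^ 2) \<le> real (card (small_products (2 * \<kappa> * l\<^sup>2) L))"
        unfolding U_def using card_reps_square_le[OF \<kappa> that AL] by (intro of_nat_mono) auto
      then have "(real (card (reps U l)))\<^sup>2 \<le> K\<^sup>2" using K(2)[of "2 * \<kappa> * l\<^sup>2"]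
        unfolding of_nat_power by linarith
      then show ?thesis using K(1) power2_le_imp_le by blast
    qed
  qed (rule K(1))
  also have "2 * (real (card U) * sqrt (1 + K) * sqrt (real_of_int p * real (card V))) \<le>
      2 * ((2 * real (card A)) * sqrt (1 + K) * sqrt (real_of_int p * (2 * real (card B))))"
  proof -
    have "card U \<le> 2 * card A" unfolding U_def using card_roots_of_le[OF \<kappa> fin(1)] .
    moreover have "card V \<le> 2 * card B"
      unfolding V_def using card_roots_of_le[OF \<kappa>, of "(*) c ` B"] card_image_le[OF fin(2), of "(*) c"] fin
      by fastforce
    ultimately have "real (card U) \<le> 2 * real (card A)" "real (card V) \<le> 2 * real (card B)"
      by linarith+
    then show ?thesis using K(1) p_pos
      by (intro mult_mono mult_left_mono real_sqrt_le_mono) auto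
  qed
  finally show ?thesis by simp
qed

text \<open>A root of \<open>\<kappa> * n\<close> divided by \<open>\<kappa>\<close> is the required
  \<open>u\<close>.\<close>

lemma exists_scaled_root:
  assumes "\<not> p dvd \<kappa>" "Legendre (\<kappa> * n) p = 1"
  shows "\<exists>u\<in>{0..<p}. [\<kappa> * u\<^sup>2 = n] (mod p)"
proof -
  define \<kappa>' where "\<kappa>' = modular_inverse p \<kappa>"
  have k: "[\<kappa> * \<kappa>' = 1] (mod p)"
    unfolding \<kappa>'_def using assms by (intro cong_modular_inverse1) (simp add: coprime_p)
  obtain y where y: "[y\<^sup>2 = \<kappa> * n] (mod p)"
    using assms(2) by (auto simp: Legendre_def QuadRes_def split: if_splits)
  have "[\<kappa> * (\<kappa>' * y)\<^sup>2 = (\<kappa> * \<kappa>') * \<kappa>' * y\<^sup>2] (mod p)" by (simp add: power2_eq_square mult_ac)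
  also have "[(\<kappa> * \<kappa>') * \<kappa>' * y\<^sup>2 = 1 * \<kappa>' * (\<kappa> * n)] (mod p)" by (intro cong_mult k y cong_refl)
  also have "1 * \<kappa>' * (\<kappa> * n) = (\<kappa> * \<kappa>') * n" by simp
  also have "[(\<kappa> * \<kappa>') * n = 1 * n] (mod p)" by (intro cong_mult k cong_refl)
  finally have root: "[\<kappa> * (\<kappa>' * y)\<^sup>2 = n] (mod p)" by simp
  have "[\<kappa> * ((\<kappa>' * y) mod p)\<^sup>2 = \<kappa> * (\<kappa>' * y)\<^sup>2] (mod p)"
    by (intro cong_mult cong_pow cong_refl) (simp add: cong_def)
  then have "[\<kappa> * ((\<kappa>' * y) mod p)\<^sup>2 = n] (mod p)" using root by (rule cong_trans)
  then show ?thesis using p_pos by (intro bexI[of _ "(\<kappa>' * y) mod p"]) auto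
qed

text \<open>A nonzero root sum at \<open>m\<close> forces \<open>Legendre n p\<close> to equal the
  symbol of \<open>4 * m * c\<close>. Pairs with different symbols thus contribute nothing, and each
  of the two classes is covered by one scale, 1 or a nonresidue; hence the factor 8, twice the 4 of
  a single class.\<close>

lemma sum_root_sum_le:
  assumes c: "\<not> p dvd c" and B: "B \<subseteq> {1..<p}" and A: "A \<subseteq> {1..<p}"
    and AL: "\<And>a b. a \<in> A \<Longrightarrow> b \<in> A \<Longrightarrow> \<bar>a - b\<bar> \<le> L"
    and K: "K \<ge> 0" "\<And>\<tau>. real (card (small_products \<tau> L)) \<le> K\<^sup>2"
  shows "(\<Sum>n1\<in>A. \<Sum>n2\<in>A. norm (\<Sum>m\<in>B. root_sum (c * n1) m * cnj (root_sum (c * n2) m))) \<le>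
    8 * real (card A) * sqrt (1 + K) * sqrt (real_of_int p * (2 * real (card B)))"
proof -
  define f where "f n1 n2 = norm (\<Sum>m\<in>B. root_sum (c * n1) m * cnj (root_sum (c * n2) m))" for n1 n2
  have fin: "finite A" using A finite_subset by blast
  \<comment> \<open>A fixed nonresidue if there is one; the default 1 keeps \<open>g\<close> coprime
    to \<open>p\<close> in either case.\<close>
  define g where "g = (if \<exists>x. Legendre x p = - 1 then SOME x. Legendre x p = - 1 else 1)"
  have g1: "Legendre g p = - 1" if "Legendre x p = - 1" for x
    using someI_ex[of "\<lambda>x. Legendre x p = - 1"] that by (auto simp: g_def)
  have nd1: "\<not> p dvd 1" using p_gt_2 by (simp add: zdvd_not_zless)
  have g: "\<not> p dvd g"
  proof (cases "\<exists>x. Legendre x p = - 1")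
    case True
    then show ?thesis using g1 by (auto simp: Legendre_def cong_0_iff)
  next
    case False
    then show ?thesis using nd1 by (simp add: g_def)
  qed
  define cls where "cls \<kappa> = {n \<in> A. \<exists>u\<in>{0..<p}. [\<kappa> * u\<^sup>2 = n] (mod p)}" for \<kappa>
  \<comment> \<open>Class indicators allow a termwise comparison of the full double sum with the two
    restricted ones.\<close>
  define h where "h \<kappa> n = (if n \<in> cls \<kappa> then 1 else 0 :: real)" for \<kappa> n
  have h0: "h \<kappa> n \<ge> 0" for \<kappa> n by (simp add: h_def)
  have ndA: "\<not> p dvd n" if "n \<in> A" for n using that A by (auto simp: zdvd_not_zless)
  have class_of: "n \<in> cls (if Legendre n p = 1 then 1 else g)" if "n \<in> A" for n
  proof (cases "Legendre n p = 1")
    case True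
    then show ?thesis using exists_scaled_root[OF nd1, of n] that by (simp add: cls_def)
  next
    case False
    then have "Legendre n p = - 1" using ndA[OF that] by (auto simp: Legendre_def cong_0_iff)
    then have "Legendre (g * n) p = 1" using g1 by (simp add: Legendre_mult)
    then show ?thesis using exists_scaled_root[OF g, of n] that False by (simp add: cls_def)
  qed
  have same_class: "Legendre n1 p = Legendre n2 p" if "f n1 n2 \<noteq> 0" "n1 \<in> A" "n2 \<in> A" for n1 n2
  proof -
    have "\<exists>m\<in>B. root_sum (c * n1) m * cnj (root_sum (c * n2) m) \<noteq> 0"
    proof (rule ccontr)
      assume "\<not> ?thesis"
      then have "f n1 n2 = 0" unfolding f_def by (subst sum.neutral) auto
      with that(1) show False by simp
    qed
    then obtain m where m: "m \<in> B" "root_sum (c * n1) m * cnj (root_sum (c * n2) m) \<noteq> 0" by blast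
    have nd: "\<not> p dvd 4 * m * c"
      using m(1) B c not_dvd_4 prime_p by (auto simp: prime_dvd_mult_iff zdvd_not_zless)
    have L: "Legendre n p = Legendre (4 * m * c) p" if n: "n \<in> A" "root_sum (c * n) m \<noteq> 0" for n
    proof -
      have "sqroots (4 * m * c * n) \<noteq> {}" using n(2) by (auto simp: root_sum_def mult_ac)
      then have "card (sqroots (4 * m * c * n)) \<noteq> 0" by simp
      then have "Legendre (4 * m * c * n) p \<noteq> - 1" using card_sqroots[of "4 * m * c * n"] by linarith
      moreover have "\<not> p dvd 4 * m * c * n" using nd ndA[OF n(1)] prime_p prime_dvd_mult_iff by blast
      ultimately have "Legendre (4 * m * c * n) p = 1"
        by (simp add: Legendre_def cong_0_iff split: if_splits)
      then have "Legendre (4 * m * c) p * Legendre n p = 1" by (simp add: Legendre_mult)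
      then show ?thesis by (auto simp: Legendre_def split: if_splits)
    qed
    show ?thesis using L[OF that(2)] L[OF that(3)] m(2) by auto
  qed
  have le: "f n1 n2 \<le> h 1 n1 * h 1 n2 * f n1 n2 + h g n1 * h g n2 * f n1 n2" if n: "n1 \<in> A" "n2 \<in> A" for n1 n2
  proof (cases "f n1 n2 = 0")
    case False
    have f0: "f n1 n2 \<ge> 0" by (simp add: f_def)
    have "(n1 \<in> cls 1 \<and> n2 \<in> cls 1) \<or> (n1 \<in> cls g \<and> n2 \<in> cls g)"
      using class_of[OF n(1)] class_of[OF n(2)] same_class[OF False n] by (auto split: if_splits)
    then show ?thesis using f0 by (auto simp: h_def)
  qed simp
  have S: "(\<Sum>n1\<in>A. \<Sum>n2\<in>A. h \<kappa> n1 * h \<kappa> n2 * f n1 n2) \<le>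
      4 * real (card A) * sqrt (1 + K) * sqrt (real_of_int p * (2 * real (card B)))" if "\<not> p dvd \<kappa>" for \<kappa>
  proof -
    have "(\<Sum>n1\<in>A. \<Sum>n2\<in>A. h \<kappa> n1 * h \<kappa> n2 * f n1 n2) =
        (\<Sum>n1\<in>A. if n1 \<in> cls \<kappa> then (\<Sum>n2\<in>A. if n2 \<in> cls \<kappa> then f n1 n2 else 0) else 0)"
      by (intro sum.cong refl) (auto simp: h_def intro!: sum.cong)
    also have "\<dots> = (\<Sum>n1\<in>cls \<kappa>. \<Sum>n2\<in>cls \<kappa>. f n1 n2)"
    proof -
      have "A \<inter> cls \<kappa> = cls \<kappa>" by (auto simp: cls_def)
      then show ?thesis using fin by (simp add: sum.inter_restrict[symmetric])
    qed
    also have "\<dots> \<le> 4 * real (card A) * sqrt (1 + K) * sqrt (real_of_int p * (2 * real (card B)))"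
      unfolding cls_def f_def by (rule sum_root_sum_class_le[OF that c B A AL K])
    finally show ?thesis .
  qed
  have "(\<Sum>n1\<in>A. \<Sum>n2\<in>A. f n1 n2) \<le>
      (\<Sum>n1\<in>A. \<Sum>n2\<in>A. h 1 n1 * h 1 n2 * f n1 n2 + h g n1 * h g n2 * f n1 n2)"
    by (intro sum_mono le)
  also have "\<dots> \<le> 8 * real (card A) * sqrt (1 + K) * sqrt (real_of_int p * (2 * real (card B)))"
    using S[OF nd1] S[OF g] by (simp add: sum.distrib)
  finally show ?thesis by (simp add: f_def)
qed

end

section \<open>Numerical estimates and conclusion\<close>

lemma dyadic_eq: "dyadic X = {\<lceil>X\<rceil>..\<lfloor>2 * X\<rfloor>}"
  by (auto simp: dyadic_def ceiling_le_iff le_floor_iff)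

lemma finite_dyadic [simp]: "finite (dyadic X)"
  by (simp add: dyadic_eq)

lemma card_dyadic_le:
  assumes "X \<ge> 1"
  shows "real (card (dyadic X)) \<le> 2 * X"
proof -
  have "real (card (dyadic X)) = real (nat (\<lfloor>2 * X\<rfloor> - \<lceil>X\<rceil> + 1))" by (simp add: dyadic_eq)
  also have "\<dots> \<le> 2 * X" using assms by linarith
  finally show ?thesis .
qed

lemma norm_salie_sum_le:
  assumes "p \<ge> 0"
  shows "norm (salie_sum m n p) \<le> real_of_int p"
proof -
  let ?X = "{x \<in> {0..<p}. coprime x p}"
  have "norm (salie_sum m n p) \<le> (\<Sum>x\<in>?X. norm (of_int (Legendre x p) *
       add_char (real_of_int (m * x + n * modular_inverse p x) / real_of_int p)))"
    unfolding salie_sum_def by (rule norm_sum)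
  also have "\<dots> \<le> (\<Sum>x\<in>?X. 1)"
    by (intro sum_mono) (auto simp: norm_mult add_char_def Legendre_def)
  also have "\<dots> = real (card ?X)" by simp
  also have "\<dots> \<le> real (card {0..<p})" by (intro of_nat_mono card_mono) auto
  finally show ?thesis using assms by simp
qed

text \<open>\<open>D\<close> bounds the divisor count of integers up to
  \<open>4 * N\<^sup>2\<close>, with divisor exponent 1/4. The three factors of the main summand
  have orders \<open>N\<close>, \<open>1 + N\<^sup>2 / P\<close> and \<open>N powr (1/2)\<close>;
  the summand linear in \<open>L\<close> is absorbed.\<close>

lemma small_products_constant:
  fixes C1 N P :: real
  assumes "C1 \<ge> 1" "N \<ge> 1" "P > 0" "0 \<le> L" "L \<le> N" "D = 2 * C1 * N powr (1/2)"
  shows "2 * (4 * L + 1) + (4 * L + 1) * (8 * L\<^sup>2 / P + 2) * (2 * D) \<le>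
    160 * C1 * N powr (3/2) * (1 + N\<^sup>2 / P)"
proof -
  define s where "s = N powr (1/2)"
  define q where "q = N\<^sup>2 / P"
  have s1: "s \<ge> 1" unfolding s_def using assms by (intro ge_one_powr_ge_zero) auto
  have q0: "q \<ge> 0" using assms by (simp add: q_def)
  have sN: "N powr (3/2) = N * s"
    using powr_add[of N 1 "1/2"] assms by (simp add: s_def)
  have L: "4 * L + 1 \<le> 5 * N" using assms by simp
  have q: "8 * L\<^sup>2 / P + 2 \<le> 8 * q + 2"
    using assms by (auto simp: q_def intro!: divide_right_mono mult_left_mono power_mono)
  have "(4 * L + 1) * (8 * L\<^sup>2 / P + 2) * (2 * D) \<le> (5 * N) * (8 * q + 2) * (2 * D)"
    using assms q0 L q by (intro mult_mono mult_right_mono mult_nonneg_nonneg add_nonneg_nonneg) auto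
  also have "\<dots> = (C1 * (N * s)) * (160 * q + 40)" by (simp add: assms s_def algebra_simps)
  finally have 1: "(4 * L + 1) * (8 * L\<^sup>2 / P + 2) * (2 * D) \<le> (C1 * (N * s)) * (160 * q + 40)" .
  have "N * 1 \<le> N * s" using assms s1 by (intro mult_left_mono) auto
  also have "1 * (N * s) \<le> C1 * (N * s)" using assms s1 by (intro mult_right_mono) auto
  finally have 2: "N \<le> C1 * (N * s)" by simp
  have "2 * (4 * L + 1) \<le> 2 * (5 * N)" using L by (rule mult_left_mono) simp
  also have "\<dots> \<le> 2 * (5 * (C1 * (N * s)))" using 2 by (intro mult_left_mono) auto
  finally have "2 * (4 * L + 1) + (4 * L + 1) * (8 * L\<^sup>2 / P + 2) * (2 * D) \<le>
      (C1 * (N * s)) * (160 * q + 50)"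
    using 1 by (simp add: algebra_simps)
  also have "\<dots> \<le> (C1 * (N * s)) * (160 * q + 160)" using assms s1 by (intro mult_left_mono) auto
  also have "\<dots> = 160 * C1 * N powr (3/2) * (1 + N\<^sup>2 / P)" by (simp add: sN q_def algebra_simps)
  finally show ?thesis .
qed

text \<open>\<open>K\<close> has order \<open>N powr (3/4) + N powr (7/4) * P powr (- 1/2)\<close>.
  The lower bound on \<open>N\<close> puts both terms under
  \<open>N\<^sup>2 * P powr (- 31/54)\<close>, the size that the final geometric mean calls
  for.\<close>

lemma sqrt_small_products_constant_le:
  fixes C1 N P :: real
  assumes C1: "C1 \<ge> 1" and P: "P \<ge> 1" and N: "N \<ge> P powr (25/54)"
  defines "K \<equiv> sqrt (160 * C1 * N powr (3/2) * (1 + N\<^sup>2 / P))"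
  shows "1 + K \<le> 52 * C1 * (N\<^sup>2 * P powr (- 31/54))"
proof -
  have "1 \<le> P powr (25/54)" using P by (intro ge_one_powr_ge_zero) auto
  then have N1: "N \<ge> 1" using N by simp
  \<comment> \<open>The tight comparison: \<open>25/54 * 5/4 = 125/216\<close>, just above
    \<open>31/54 = 124/216\<close>.\<close>
  have "P powr (31/54) \<le> (P powr (25/54)) powr (5/4)"
    using P by (simp add: powr_powr powr_mono)
  also have "\<dots> \<le> N powr (5/4)" using N by (intro powr_mono2) auto
  finally have "N powr (3/4) * P powr (31/54) \<le> N powr (3/4) * N powr (5/4)"
    by (intro mult_left_mono) auto
  also have "\<dots> = N\<^sup>2" using N1 by (simp flip: powr_add)
  finally have a: "N powr (3/4) \<le> N\<^sup>2 * P powr (- 31/54)"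
    using P by (simp add: powr_minus field_simps)
  \<comment> \<open>The gap to be covered is \<open>31/54 - 1/2 = 2/27 = 16/216\<close>, and
    \<open>25/54 * 1/4 = 25/216\<close>.\<close>
  have "P powr (2/27) \<le> (P powr (25/54)) powr (1/4)"
    using P by (simp add: powr_powr powr_mono)
  also have "\<dots> \<le> N powr (1/4)" using N by (intro powr_mono2) auto
  finally have "N powr (7/4) * P powr (2/27) \<le> N powr (7/4) * N powr (1/4)"
    by (intro mult_left_mono) auto
  also have "\<dots> = N\<^sup>2" using N1 by (simp flip: powr_add)
  finally have "N powr (7/4) * P powr (2/27) * P powr (- 31/54) \<le> N\<^sup>2 * P powr (- 31/54)"
    by (intro mult_right_mono) auto
  then have b: "N powr (7/4) * P powr (- 1/2) \<le> N\<^sup>2 * P powr (- 31/54)"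
    using P by (simp add: mult.assoc flip: powr_add)
  have "K = sqrt (160 * C1) * (N powr (3/4) * sqrt (1 + N\<^sup>2 / P))"
  proof -
    have "sqrt (N powr (3/2)) = N powr (3/4)"
      using N1 by (simp add: powr_powr flip: powr_half_sqrt)
    then show ?thesis unfolding K_def by (simp add: real_sqrt_mult)
  qed
  also have "\<dots> \<le> (13 * C1) * (N powr (3/4) * (1 + N * P powr (- 1/2)))"
  proof (intro mult_mono mult_left_mono)
    \<comment> \<open>The constant 13 is chosen since its square 169 exceeds 160.\<close>
    have "160 * C1 \<le> (13 * C1)\<^sup>2"
      using C1 mult_mono[of 1 C1 1 C1] by (simp add: power2_eq_square)
    then show "sqrt (160 * C1) \<le> 13 * C1" using C1 by (intro real_le_lsqrt) auto
    have "sqrt (1 + N\<^sup>2 / P) \<le> sqrt 1 + sqrt (N\<^sup>2 / P)"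
      using P by (intro sqrt_add_le_add_sqrt) auto
    also have "sqrt (N\<^sup>2 / P) = N * P powr (- 1/2)"
      using P N1 by (simp add: real_sqrt_divide powr_minus powr_half_sqrt field_simps)
    finally show "sqrt (1 + N\<^sup>2 / P) \<le> 1 + N * P powr (- 1/2)" by simp
  qed (use C1 P in auto)
  also have "N powr (3/4) * (1 + N * P powr (- 1/2)) = N powr (3/4) + N powr (7/4) * P powr (- 1/2)"
    using N1 powr_add[of N "3/4" 1] by (simp add: algebra_simps)
  also have "(13 * C1) * \<dots> \<le> (13 * C1) * (2 * (N\<^sup>2 * P powr (- 31/54)))"
    using a b C1 by (intro mult_left_mono) auto
  finally have K: "K \<le> 26 * C1 * (N\<^sup>2 * P powr (- 31/54))" by simp
  have "1 \<le> N powr (3/4)" using N1 by (intro ge_one_powr_ge_zero) auto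
  then have "1 \<le> N\<^sup>2 * P powr (- 31/54)" using a by simp
  moreover from this have "1 * (N\<^sup>2 * P powr (- 31/54)) \<le> C1 * (N\<^sup>2 * P powr (- 31/54))"
    using C1 by (intro mult_right_mono) auto
  ultimately have "1 \<le> 26 * (C1 * (N\<^sup>2 * P powr (- 31/54)))" by linarith
  with K show ?thesis by simp
qed

text \<open>The square of the left side is \<open>P ^ 3 * N\<^sup>2 * M * k\<close>. As
  \<open>3 - 31/54 = 26/27 + 79/54\<close>, it is at most a constant times the product of the two
  terms on the right, and \<open>X * Y \<le> (X + Y)\<^sup>2\<close> for nonnegative
  numbers.\<close>

lemma geometric_mean_le:
  fixes C1 N M P k :: real
  assumes C1: "C1 \<ge> 1" and P: "P \<ge> 1" and N: "N \<ge> 0" and M: "M \<ge> 0"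
    and k: "0 \<le> k" "k \<le> 52 * C1 * (N\<^sup>2 * P powr (- 31/54))"
  shows "P * (N * sqrt k * sqrt (P * M)) \<le> 8 * C1 * (M * N\<^sup>2 * P powr (26/27) + N\<^sup>2 * P powr (79/54))"
proof -
  define X where "X = M * N\<^sup>2 * P powr (26/27)"
  define Y where "Y = N\<^sup>2 * P powr (79/54)"
  have XY: "X \<ge> 0" "Y \<ge> 0" using M by (auto simp: X_def Y_def)
  have P3: "P ^ 3 * P powr (- 31/54) = P powr (131/54)"
    using P powr_add[of P 3 "- 31/54"] by simp
  have sq: "(sqrt k)\<^sup>2 = k" "(sqrt (P * M))\<^sup>2 = P * M" using k P M by simp_all
  have "(P * (N * sqrt k * sqrt (P * M)))\<^sup>2 = P ^ 3 * N\<^sup>2 * M * k"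
    unfolding power_mult_distrib sq by (simp add: power2_eq_square power3_eq_cube)
  also have "\<dots> \<le> P ^ 3 * N\<^sup>2 * M * (52 * C1 * (N\<^sup>2 * P powr (- 31/54)))"
    using k P M by (intro mult_left_mono) auto
  also have "\<dots> = 52 * C1 * M * N ^ 4 * (P ^ 3 * P powr (- 31/54))"
    by (simp add: power2_eq_square power4_eq_xxxx mult_ac)
  also have "\<dots> = 52 * C1 * (X * Y)"
    unfolding P3 using powr_add[of P "26/27" "79/54"]
    by (simp add: X_def Y_def power2_eq_square power4_eq_xxxx mult_ac)
  also have "\<dots> \<le> (64 * (C1 * C1)) * ((X + Y) * (X + Y))"
  proof (rule mult_mono)
    show "52 * C1 \<le> 64 * (C1 * C1)" using C1 mult_mono[of 1 C1 C1 C1] by simp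
    show "X * Y \<le> (X + Y) * (X + Y)" using XY by (intro mult_mono) auto
  qed (use XY C1 in auto)
  also have "\<dots> = (8 * C1 * (X + Y))\<^sup>2" by (simp add: power2_eq_square)
  finally have "P * (N * sqrt k * sqrt (P * M)) \<le> 8 * C1 * (X + Y)"
    by (rule power2_le_imp_le) (use XY C1 in auto)
  then show ?thesis by (simp add: X_def Y_def)
qed

section \<open>The bound for one prime\<close>

context odd_prime
begin

lemma norm_root_sum_mult_cnj_le: "norm (root_sum a m * cnj (root_sum b m)) \<le> 4"
proof -
  have "norm (root_sum a m * cnj (root_sum b m)) \<le> 2 * 2"
    unfolding norm_mult complex_mod_cnj by (intro mult_mono norm_root_sum_le) auto
  then show ?thesis by simp
qed

text \<open>The constant 272 is \<open>32 * 8\<close> from the geometric mean plus 16 from the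
  possible term \<open>m = p\<close>. The condition \<open>2 * N < p\<close> keeps all
  \<open>n\<close> among the nonzero residues.\<close>

lemma salie_correlation_le:
  fixes C1 N M :: real
  assumes C1: "C1 \<ge> 1" and divisors: "\<And>n::nat. n > 0 \<Longrightarrow> real (card {d. d dvd n}) \<le> C1 * real n powr (1/4)"
    and N: "real_of_int p powr (25/54) \<le> N" "2 * N < real_of_int p"
    and M: "1 \<le> M" "M \<le> real_of_int p / 2" and c: "\<not> p dvd c"
  shows "(\<Sum>n1 \<in> dyadic N. \<Sum>n2 \<in> dyadic N. norm (\<Sum>m \<in> dyadic M.
      salie_sum m (c * n1) p * cnj (salie_sum m (c * n2) p)))
    \<le> 272 * C1 * (M * N\<^sup>2 * p powr (26/27) + N\<^sup>2 * p powr (79/54))"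
proof -
  define A where "A = dyadic N"
  \<comment> \<open>The value \<open>m = p\<close> lies in the range only if
    \<open>M = p / 2\<close>. Merging the root sets asks for \<open>m\<close> prime to
    \<open>p\<close>, so this term is split off; its product of root sums has modulus at most
    4.\<close>
  define B where "B = dyadic M - {p}"
  define L where "L = \<lfloor>N\<rfloor>"
  define K where "K = sqrt (160 * C1 * N powr (3/2) * (1 + N\<^sup>2 / p))"
  define Z where "Z = M * N\<^sup>2 * p powr (26/27) + N\<^sup>2 * p powr (79/54)"
  have P1: "real_of_int p \<ge> 1" using p_gt_2 by simp
  have "1 \<le> real_of_int p powr (25/54)" using P1 by (intro ge_one_powr_ge_zero) auto
  then have N1: "N \<ge> 1" using N by simp
  have A: "A \<subseteq> {1..<p}" "real (card A) \<le> 2 * N"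
    using N N1 card_dyadic_le[OF N1] unfolding A_def by (auto simp: dyadic_def)
  have B: "B \<subseteq> {1..<p}"
  proof
    fix m assume m: "m \<in> B"
    then have "1 \<le> real_of_int m" "real_of_int m \<le> real_of_int p" "m \<noteq> p"
      using M by (auto simp: B_def dyadic_def)
    then show "m \<in> {1..<p}" by simp
  qed
  have "card B \<le> card (dyadic M)" unfolding B_def by (intro card_mono) auto
  then have cB: "real (card B) \<le> 2 * M" using card_dyadic_le[OF M(1)] by linarith
  have L: "1 \<le> L" "real_of_int L \<le> N" using N1 by (auto simp: L_def le_floor_iff)
  have AL: "\<bar>a - b\<bar> \<le> L" if "a \<in> A" "b \<in> A" for a b
  proof -
    have "real_of_int \<bar>a - b\<bar> \<le> N" using that by (auto simp: A_def dyadic_def)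
    then show ?thesis unfolding L_def by (simp only: le_floor_iff)
  qed
  have arg0: "0 \<le> 160 * C1 * N powr (3/2) * (1 + N\<^sup>2 / p)"
    using C1 P1 by (intro mult_nonneg_nonneg add_nonneg_nonneg) auto
  then have K0: "K \<ge> 0" unfolding K_def by (rule real_sqrt_ge_zero)
  have sp: "real (card (small_products \<tau> L)) \<le> K\<^sup>2" for \<tau>
  proof -
    define D where "D = 2 * C1 * N powr (1/2)"
    have D: "real (card {d. d dvd n}) \<le> D" if "0 < n" "int n \<le> 4 * L\<^sup>2" for n :: nat
    proof -
      have "real n = real_of_int (int n)" by simp
      also have "\<dots> \<le> real_of_int (4 * L\<^sup>2)" using that by (subst of_int_le_iff)
      also have "\<dots> \<le> 4 * N\<^sup>2" using L by (simp add: power_mono)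
      finally have "real n powr (1/4) \<le> (4 * N\<^sup>2) powr (1/4)" by (intro powr_mono2) auto
      also have "\<dots> = 4 powr (1/4) * N powr (1/2)"
      proof -
        have "(N\<^sup>2) powr (1/4) = (N powr 2) powr (1/4)" using N1 by simp
        also have "\<dots> = N powr (1/2)" unfolding powr_powr by simp
        finally show ?thesis by (simp add: powr_mult)
      qed
      also have "\<dots> \<le> 2 * N powr (1/2)"
      proof (intro mult_right_mono)
        have "(4::real) powr (1/4) \<le> 4 powr (1/2)" by (intro powr_mono) auto
        then show "(4::real) powr (1/4) \<le> 2" by (simp add: powr_half_sqrt)
      qed auto
      finally have "C1 * real n powr (1/4) \<le> C1 * (2 * N powr (1/2))"
        using C1 by (intro mult_left_mono) auto
      with divisors[OF that(1)] show ?thesis by (simp add: D_def)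
    qed
    have "real (card (small_products \<tau> L)) \<le>
        2 * (4 * real_of_int L + 1) + (4 * real_of_int L + 1) * (8 * (real_of_int L)\<^sup>2 / p + 2) * (2 * D)"
      using card_small_products_le[OF L(1) D, of \<tau>] by simp
    also have "\<dots> \<le> 160 * C1 * N powr (3/2) * (1 + N\<^sup>2 / p)"
      using C1 N1 P1 L by (intro small_products_constant) (auto simp: D_def)
    also have "\<dots> = K\<^sup>2" unfolding K_def using arg0 by (rule real_sqrt_pow2[symmetric])
    finally show ?thesis .
  qed
  have ndn: "\<not> p dvd c * n" if "n \<in> A" for n
    using that A(1) c prime_p by (auto simp: prime_dvd_mult_iff zdvd_not_zless)
  have trunc: "norm (\<Sum>m \<in> dyadic M. salie_sum m (c * n1) p * cnj (salie_sum m (c * n2) p)) \<le>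
      p * norm (\<Sum>m\<in>B. root_sum (c * n1) m * cnj (root_sum (c * n2) m)) + 4 * p"
    if "n1 \<in> A" "n2 \<in> A" for n1 n2
  proof -
    define f where "f m = root_sum (c * n1) m * cnj (root_sum (c * n2) m)" for m
    have f4: "norm (f m) \<le> 4" for m unfolding f_def by (rule norm_root_sum_mult_cnj_le)
    have "norm (\<Sum>m\<in>dyadic M. f m) \<le> norm (\<Sum>m\<in>B. f m) + 4"
    proof (cases "p \<in> dyadic M")
      case True
      then have "(\<Sum>m\<in>dyadic M. f m) = (\<Sum>m\<in>B. f m) + f p"
        unfolding B_def by (simp add: sum.remove)
      then show ?thesis using norm_triangle_ineq[of "\<Sum>m\<in>B. f m" "f p"] f4[of p] by simp
    next
      case False
      then show ?thesis by (simp add: B_def)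
    qed
    then have "p * norm (\<Sum>m\<in>dyadic M. f m) \<le> p * (norm (\<Sum>m\<in>B. f m) + 4)"
      using P1 by (intro mult_left_mono) auto
    then show ?thesis
      unfolding norm_sum_salie[OF ndn[OF that(1)] ndn[OF that(2)]] f_def by (simp add: algebra_simps)
  qed
  have "(\<Sum>n1 \<in> A. \<Sum>n2 \<in> A. norm (\<Sum>m \<in> dyadic M.
      salie_sum m (c * n1) p * cnj (salie_sum m (c * n2) p))) \<le>
    (\<Sum>n1 \<in> A. \<Sum>n2 \<in> A. p * norm (\<Sum>m\<in>B. root_sum (c * n1) m * cnj (root_sum (c * n2) m)) + 4 * p)"
    by (intro sum_mono trunc)
  also have "\<dots> = p * (\<Sum>n1 \<in> A. \<Sum>n2 \<in> A. norm (\<Sum>m\<in>B. root_sum (c * n1) m * cnj (root_sum (c * n2) m)))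
      + 4 * p * (real (card A))\<^sup>2"
    by (simp add: sum.distrib sum_distrib_left power2_eq_square mult_ac)
  also have "\<dots> \<le> p * (8 * (2 * N) * sqrt (1 + K) * sqrt (p * (2 * (2 * M)))) + 4 * p * (2 * N)\<^sup>2"
  proof -
    have "(\<Sum>n1 \<in> A. \<Sum>n2 \<in> A. norm (\<Sum>m\<in>B. root_sum (c * n1) m * cnj (root_sum (c * n2) m))) \<le>
        8 * real (card A) * sqrt (1 + K) * sqrt (real_of_int p * (2 * real (card B)))"
      by (rule sum_root_sum_le[OF c B A(1) AL K0 sp])
    also have "\<dots> \<le> 8 * (2 * N) * sqrt (1 + K) * sqrt (p * (2 * (2 * M)))"
      using A(2) cB K0 P1 N1 by (intro mult_mono mult_left_mono mult_right_mono real_sqrt_le_mono) auto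
    finally show ?thesis
      using A(2) P1 by (intro add_mono mult_left_mono power_mono) auto
  qed
  also have "sqrt (p * (2 * (2 * M))) = 2 * sqrt (p * M)"
    using real_sqrt_mult[of 4 "p * M"] by (simp add: mult_ac)
  also have "p * (8 * (2 * N) * sqrt (1 + K) * (2 * sqrt (p * M))) = 32 * (p * (N * sqrt (1 + K) * sqrt (p * M)))"
    by (simp add: mult_ac)
  also have "32 * (p * (N * sqrt (1 + K) * sqrt (p * M))) \<le> 32 * (8 * C1 * Z)"
  proof -
    have "1 + K \<le> 52 * C1 * (N\<^sup>2 * p powr (- 31/54))"
      unfolding K_def by (rule sqrt_small_products_constant_le[OF C1 P1 N(1)])
    then have "p * (N * sqrt (1 + K) * sqrt (p * M)) \<le> 8 * C1 * Z"
      unfolding Z_def using C1 P1 N1 M K0 by (intro geometric_mean_le) auto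
    then show ?thesis by (rule mult_left_mono) simp
  qed
  \<comment> \<open>The terms \<open>m = p\<close> over all pairs fit into the third term of the
    claim because \<open>79/54 > 1\<close>.\<close>
  also have "4 * p * (2 * N)\<^sup>2 \<le> 16 * C1 * Z"
  proof -
    have "real_of_int p = p powr 1" using P1 by simp
    also have "\<dots> \<le> p powr (79/54)" using P1 by (intro powr_mono) auto
    finally have "N\<^sup>2 * p \<le> N\<^sup>2 * p powr (79/54)" by (intro mult_left_mono) auto
    also have "\<dots> \<le> Z" using M by (simp add: Z_def)
    finally have Z: "N\<^sup>2 * p \<le> Z" .
    moreover have "1 * Z \<le> C1 * Z" using C1 Z P1 by (intro mult_right_mono) (auto intro: order_trans[rotated])
    ultimately show ?thesis by (simp add: power2_eq_square mult_ac)
  qed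
  finally show ?thesis by (simp add: A_def Z_def algebra_simps)
qed

text \<open>By the evaluation each product of Salie sums has size at most \<open>4 * p\<close>;
  there are at most \<open>2 * M\<close> values of \<open>m\<close> and \<open>4 * N\<^sup>2\<close>
  pairs.\<close>

lemma salie_correlation_trivial:
  fixes N M :: real
  assumes N: "1 \<le> N" "2 * N < real_of_int p" and M: "1 \<le> M" and c: "\<not> p dvd c"
  shows "(\<Sum>n1 \<in> dyadic N. \<Sum>n2 \<in> dyadic N. norm (\<Sum>m \<in> dyadic M.
      salie_sum m (c * n1) p * cnj (salie_sum m (c * n2) p))) \<le> 32 * (M * N\<^sup>2 * p)"
proof -
  have ndn: "\<not> p dvd c * n" if "n \<in> dyadic N" for n
  proof -
    have "0 < real_of_int n" "real_of_int n < real_of_int p" using that N by (auto simp: dyadic_def)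
    then have "\<not> p dvd n" by (simp add: zdvd_not_zless)
    then show ?thesis using c prime_p by (simp add: prime_dvd_mult_iff)
  qed
  have "norm (\<Sum>m \<in> dyadic M. salie_sum m (c * n1) p * cnj (salie_sum m (c * n2) p)) \<le> p * (8 * M)"
    if "n1 \<in> dyadic N" "n2 \<in> dyadic N" for n1 n2
    unfolding norm_sum_salie[OF ndn[OF that(1)] ndn[OF that(2)]]
  proof (intro mult_left_mono)
    have "norm (\<Sum>m\<in>dyadic M. root_sum (c * n1) m * cnj (root_sum (c * n2) m)) \<le> (\<Sum>m\<in>dyadic M. 4)"
      by (intro sum_norm_le norm_root_sum_mult_cnj_le)
    also have "\<dots> \<le> 8 * M" using card_dyadic_le[OF M] by simp
    finally show "norm (\<Sum>m\<in>dyadic M. root_sum (c * n1) m * cnj (root_sum (c * n2) m)) \<le> 8 * M" .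
  qed (use p_gt_2 in auto)
  then have "(\<Sum>n1 \<in> dyadic N. \<Sum>n2 \<in> dyadic N. norm (\<Sum>m \<in> dyadic M.
      salie_sum m (c * n1) p * cnj (salie_sum m (c * n2) p))) \<le>
      (\<Sum>n1 \<in> dyadic N. \<Sum>n2 \<in> dyadic N. p * (8 * M))"
    by (intro sum_mono)
  also have "\<dots> = (real (card (dyadic N)))\<^sup>2 * (p * (8 * M))" by (simp add: power2_eq_square)
  also have "\<dots> \<le> (2 * N)\<^sup>2 * (p * (8 * M))"
    using card_dyadic_le[OF N(1)] M p_gt_2 by (intro mult_right_mono power_mono) auto
  finally show ?thesis by (simp add: power2_eq_square mult_ac)
qed

end

lemma salie_correlation_small:
  fixes N M :: real and p :: int
  assumes N: "1 \<le> N" and M: "1 \<le> M" and p: "0 \<le> p" "p < 7"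
  shows "(\<Sum>n1 \<in> dyadic N. \<Sum>n2 \<in> dyadic N. norm (\<Sum>m \<in> dyadic M.
      salie_sum m (c * n1) p * cnj (salie_sum m (c * n2) p))) \<le> 392 * (M * N\<^sup>2)"
proof -
  have S: "norm (salie_sum m n p) \<le> 7" for m n
    using norm_salie_sum_le[OF p(1), of m n] p by linarith
  have "norm (\<Sum>m \<in> dyadic M. salie_sum m (c * n1) p * cnj (salie_sum m (c * n2) p)) \<le> 98 * M" for n1 n2
  proof -
    have "norm (\<Sum>m \<in> dyadic M. salie_sum m (c * n1) p * cnj (salie_sum m (c * n2) p)) \<le> (\<Sum>m\<in>dyadic M. 7 * 7)"
      by (intro sum_norm_le) (unfold norm_mult complex_mod_cnj, intro mult_mono S, auto)
    also have "\<dots> \<le> 98 * M" using card_dyadic_le[OF M] by simp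
    finally show ?thesis .
  qed
  then have "(\<Sum>n1 \<in> dyadic N. \<Sum>n2 \<in> dyadic N. norm (\<Sum>m \<in> dyadic M.
      salie_sum m (c * n1) p * cnj (salie_sum m (c * n2) p))) \<le>
      (\<Sum>n1 \<in> dyadic N. \<Sum>n2 \<in> dyadic N. 98 * M)"
    by (intro sum_mono)
  also have "\<dots> = (real (card (dyadic N)))\<^sup>2 * (98 * M)" by (simp add: power2_eq_square)
  also have "\<dots> \<le> (2 * N)\<^sup>2 * (98 * M)"
    using card_dyadic_le[OF N] M by (intro mult_right_mono power_mono) auto
  finally show ?thesis by (simp add: power2_eq_square mult_ac)
qed

theorem theorem1p2:
  fixes \<epsilon> :: real
  assumes "\<epsilon> > 0"
  shows "\<exists>C::real. C > 0 \<and>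
    (\<forall>(p::int) (N::real) (M::real) (c::int).
       prime p \<longrightarrow> [p = 1] (mod 4) \<longrightarrow>
       real_of_int p powr (2/5) \<le> N \<longrightarrow> N \<le> real_of_int p powr (3/5) \<longrightarrow>
       1 \<le> M \<longrightarrow> M \<le> real_of_int p / 2 \<longrightarrow>
       \<not> p dvd c \<longrightarrow>
       (\<Sum>n1 \<in> dyadic N. \<Sum>n2 \<in> dyadic N.
          norm (\<Sum>m \<in> dyadic M.
             salie_sum m (c * n1) p * cnj (salie_sum m (c * n2) p)))
       \<le> C * (M * N\<^sup>2 * real_of_int p powr (26/27 + \<epsilon>)
              + M * N * real_of_int p powr (79/54 + \<epsilon>)
              + N\<^sup>2 * real_of_int p powr (79/54 + \<epsilon>)
              + N * real_of_int p powr (53/27 + \<epsilon>)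
              + N powr (1/2) * real_of_int p powr (239/108)
              + real_of_int p powr (133/54)))"
proof -
  obtain C1 where C1: "C1 \<ge> 1"
    and divisors: "\<And>n::nat. n > 0 \<Longrightarrow> real (card {d. d dvd n}) \<le> C1 * real n powr (1/4)"
    using divisor_bound[of "1/4"] by auto
  show ?thesis
  \<comment> \<open>The largest of the three constants 392, 272 and 32 from the cases below.\<close>
  proof (intro exI[of _ "392 * C1"] conjI allI impI)
    show "392 * C1 > 0" using C1 by simp
    fix p c :: int and N M :: real
    assume p: "prime p" "[p = 1] (mod 4)" and N: "real_of_int p powr (2/5) \<le> N" "N \<le> real_of_int p powr (3/5)"
      and M: "1 \<le> M" "M \<le> real_of_int p / 2" and c: "\<not> p dvd c"
    define P where "P = real_of_int p"
    define a where "a = M * N\<^sup>2 * P powr (26/27 + \<epsilon>)"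
    define b where "b = M * N * P powr (79/54 + \<epsilon>)"
    define d where "d = N\<^sup>2 * P powr (79/54 + \<epsilon>)"
    define T where "T = a + b + d + N * P powr (53/27 + \<epsilon>) + N powr (1/2) * P powr (239/108) + P powr (133/54)"
    define S where "S = (\<Sum>n1 \<in> dyadic N. \<Sum>n2 \<in> dyadic N. norm (\<Sum>m \<in> dyadic M.
             salie_sum m (c * n1) p * cnj (salie_sum m (c * n2) p)))"
    have p2: "p > 2"
    proof -
      have "p \<noteq> 2" using p(2) by (auto simp: cong_def)
      then show ?thesis using prime_ge_2_int[OF p(1)] by linarith
    qed
    interpret odd_prime p using p(1) p2 by unfold_locales
    have P1: "P \<ge> 1" using p2 by (simp add: P_def)
    have "1 \<le> P powr (2/5)" using P1 by (intro ge_one_powr_ge_zero) auto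
    then have N1: "N \<ge> 1" using N by (simp add: P_def)
    have nonneg: "a \<ge> 0" "b \<ge> 0" "d \<ge> 0" using N1 M by (auto simp: a_def b_def d_def)
    moreover have "N * P powr (53/27 + \<epsilon>) \<ge> 0" "N powr (1/2) * P powr (239/108) \<ge> 0" "P powr (133/54) \<ge> 0"
      using N1 by auto
    ultimately have T: "a + d \<le> T" "a \<le> T" "b \<le> T" "T \<ge> 0" unfolding T_def by linarith+
    have T1: "T \<le> C1 * T" using mult_right_mono[OF C1 T(4)] by simp
    have a_ge: "M * N\<^sup>2 * P powr (26/27) \<le> a" "M * N\<^sup>2 \<le> a"
      and b_ge: "M * N * P powr (79/54) \<le> b" and d_ge: "N\<^sup>2 * P powr (79/54) \<le> d"
    proof -
      have "P powr (26/27) \<le> P powr (26/27 + \<epsilon>)" "P powr (79/54) \<le> P powr (79/54 + \<epsilon>)"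
        using P1 assms by (auto intro: powr_mono)
      then show "M * N\<^sup>2 * P powr (26/27) \<le> a" "M * N * P powr (79/54) \<le> b" "N\<^sup>2 * P powr (79/54) \<le> d"
        unfolding a_def b_def d_def using M N1 by (auto intro!: mult_left_mono)
      have "1 \<le> P powr (26/27 + \<epsilon>)" using P1 assms by (intro ge_one_powr_ge_zero) auto
      then have "M * N\<^sup>2 * 1 \<le> a" unfolding a_def using M by (intro mult_left_mono) auto
      then show "M * N\<^sup>2 \<le> a" by simp
    qed
    have "S \<le> 392 * (C1 * T)"
    proof (cases "p < 7")
      case True
      then have "S \<le> 392 * (M * N\<^sup>2)"
        unfolding S_def using N1 M p2 by (intro salie_correlation_small) auto
      then show ?thesis using a_ge(2) T T1 by linarith
    next
      case False
      have "2 * N < P"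
      proof -
        \<comment> \<open>From \<open>P\<^sup>2 \<ge> 49 > 32\<close> one gets
          \<open>P powr (2/5) > 2\<close>, which is the factor between \<open>P powr (3/5)\<close>
          and \<open>P\<close>.\<close>
        have "(2::real) = 32 powr (1/5)"
        proof -
          have "(2 powr 5) powr (1/5) = (2::real)" by (subst powr_powr) simp
          then show ?thesis by simp
        qed
        also have "(32::real) powr (1/5) < (P powr 2) powr (1/5)"
        proof (rule powr_less_mono2)
          have "(7::real) * 7 \<le> P * P" using False by (intro mult_mono) (auto simp: P_def)
          then show "32 < P powr 2" using P1 by (simp add: power2_eq_square)
        qed auto
        finally have "2 < P powr (2/5)" by (simp add: powr_powr)
        moreover have "0 < P powr (3/5)" using P1 by simp
        ultimately have "2 * P powr (3/5) < P powr (2/5) * P powr (3/5)" by (rule mult_strict_right_mono)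
        then show ?thesis using N(2) P1 by (simp add: P_def flip: powr_add)
      qed
      then have N2: "2 * N < real_of_int p" by (simp add: P_def)
      show ?thesis
      \<comment> \<open>The threshold is \<open>79/54 - 1\<close>: below it
        \<open>N * P \<le> P powr (79/54)\<close>, so the trivial bound fits into the second
        term.\<close>
      proof (cases "P powr (25/54) \<le> N")
        case True
        have "S \<le> 272 * C1 * (M * N\<^sup>2 * P powr (26/27) + N\<^sup>2 * P powr (79/54))"
          unfolding S_def P_def using True
          by (intro salie_correlation_le[OF C1 divisors _ N2 M c]) (auto simp: P_def)
        also have "\<dots> \<le> 272 * C1 * T"
          using C1 a_ge d_ge T by (intro mult_left_mono) auto
        also have "\<dots> \<le> 392 * (C1 * T)" using T1 T(4) by simp
        finally show ?thesis .
      next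
        case False
        have "S \<le> 32 * (M * N\<^sup>2 * P)"
          unfolding S_def P_def by (rule salie_correlation_trivial[OF N1 N2 M(1) c])
        also have "M * N\<^sup>2 * P \<le> M * N * P powr (79/54)"
        proof -
          have "N * P \<le> P powr (25/54) * P powr 1" using False P1 by (intro mult_mono) auto
          also have "\<dots> = P powr (79/54)" unfolding powr_add[symmetric] by simp
          finally have "(M * N) * (N * P) \<le> (M * N) * P powr (79/54)"
            using M N1 by (intro mult_left_mono) auto
          then show ?thesis by (simp add: power2_eq_square mult_ac)
        qed
        finally show ?thesis using b_ge T T1 by linarith
      qed
    qed
    then show "(\<Sum>n1 \<in> dyadic N. \<Sum>n2 \<in> dyadic N. norm (\<Sum>m \<in> dyadic M.
             salie_sum m (c * n1) p * cnj (salie_sum m (c * n2) p)))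
       \<le> 392 * C1 * (M * N\<^sup>2 * real_of_int p powr (26/27 + \<epsilon>)
              + M * N * real_of_int p powr (79/54 + \<epsilon>)
              + N\<^sup>2 * real_of_int p powr (79/54 + \<epsilon>)
              + N * real_of_int p powr (53/27 + \<epsilon>)
              + N powr (1/2) * real_of_int p powr (239/108)
              + real_of_int p powr (133/54))"
      unfolding S_def T_def a_def b_def d_def P_def by (simp only: mult.assoc)
  qed
qed

end
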